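(* Let $\mathcal{G}=(V,\mathcal{E})$ be a connected graph with countable vertex set, endowed with a weight function $a$ that makes it a transient weighted graph. There exists a unique $\sigma$-finite measure $\nu$ on $(W^*,\mathcal{W}^* )$ satisfying, for each finite set $K\subset V$, $$1_{W^*_K}\cdot \nu = \pi^*\circ Q_K ,$$ where $\pi^*\circ Q_K$ denotes the image (push-forward) of $Q_K$ under $\pi^*$, and where the finite measure $Q_K$ on $W_K$ is determined by the following: for all $A,B\in\mathcal{W}_+$ and every $x\in V$, $$Q_K\big[(X_{-n})_{n\ge 0}\in A,\ X_0=x,\ (X_n)_{n\ge 0}\in B\big]=P_x\big[A\,\big|\,\widetilde H_K=\infty\big]\; e_K(x)\; P_x[B]$$ (the right-hand side being $0$ when $e_K(x)=0$).
   Context: Weighted graphs. $\mathcal{G}=(V,\mathcal{E})$ is a connected graph with $V$ countable and $\mathcal{E}\subset\{\{x,y\}\subset V;\ x\neq y\}$; $x\leftrightarrow y$ means $\{x,y\}\in\mathcal{E}$. A weight function is a symmetric map $a:V\times V\to\mathbb{R}_+$ with $a_{x,y}>0$ if and only if $\{x,y\}\in\mathcal{E}$. Put $\mu_x=\sum_{y:\{x,y\}\in\mathcal{E}}a_{x,y}$, assumed finite. $P_x$ is the law of the Markov chain (random walk) started at $x$ with transition probabilities $q(x,y)=a_{x,y}/\mu_x$. The weighted graph is transient if this walk is transient. Trajectory spaces. $W_+$ is the set of $\gamma:\mathbb{N}\to V$ (with $0\in\mathbb{N}$) such that $\gamma(n)\leftrightarrow\gamma(n+1)$ for all $n\ge 0$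 and $\{n;\gamma(n)=y\}$ is finite for all $y\in V$; $\mathcal{W}_+$ is the $\sigma$-algebra on $W_+$ generated by the canonical coordinates $X_n$. By transience, $P_x$ is supported on $W_+$. $W$ is the set of $\gamma:\mathbb{Z}\to V$ such that $\gamma(n)\leftrightarrow\gamma(n+1)$ for all $n\in\mathbb{Z}$ and $\{n;\gamma(n)=y\}$ is finite for all $y\in V$; $\mathcal{W}$ is the $\sigma$-algebra on $W$ generated by the canonical coordinates $X_n$, $n\in\mathbb{Z}$. $W^*=W/\sim$, where $w\sim w'$ iff $w(\cdot)=w'(\cdot+k)$ for some $k\in\mathbb{Z}$; $\pi^*:W\to W^*$ is the canonical projection, and $\mathcal{W}^*=\{A\subset W^*;\ (\pi^* )^{-1}(A)\in\mathcal{W}\}$. For finite $K\subset V$, $W_K\subset W$ is the set of trajectories in $W$ that enter $K$, and $W^*_K=\pi^*(W_K)$. Equilibrium measure. For $w\in W_+$ and $K\subset V$, $\widetilde H_K(w)=\inf\{n\ge 1;\ X_n(w)\in K\}$. For finite $K\subset V$, $e_K(x)=1_{\{x\in K\}}\,P_x[\widetilde H_K=\infty]\,\mu_x$. *)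

theory Defs
  imports "HOL-Probability.Probability"
begin

text \<open>
  The law of the Markov chain with one-step distributions \<open>p\<close> and starting point \<open>x\<close>, as a
  measure on all of \<open>nat \<Rightarrow> 'v\<close> with the product sigma-algebra, obtained from the library's
  Ionescu Tulcea theorem.  The lemma \<open>markov_law_cylinder\<close> below gives its finite-dimensional
  distributions.
\<close>

definition markov_kernel :: "('v \<Rightarrow> 'v pmf) \<Rightarrow> 'v \<Rightarrow> nat \<Rightarrow> (nat \<Rightarrow> 'v) \<Rightarrow> 'v measure" where
  "markov_kernel p x n w =
     measure_pmf (case n of 0 \<Rightarrow> return_pmf x | Suc m \<Rightarrow> p (w m))"

interpretation markov: Ionescu_Tulcea "markov_kernel p x" "\<lambda>_. count_space UNIV"
  for p :: "'v \<Rightarrow> 'v pmf" and x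
proof (rule Ionescu_Tulcea.intro, goal_cases)
  case (1 i)
  show ?case
  proof (cases i)
    case 0
    then show ?thesis
      by (auto simp: markov_kernel_def[abs_def] measure_pmf_in_subprob_algebra)
  next
    case (Suc m)
    have "(\<lambda>w. w m) \<in> measurable (PiM {0..<Suc m} (\<lambda>_. count_space (UNIV :: 'v set))) (count_space UNIV)"
      by (rule measurable_component_singleton) simp
    moreover have "(\<lambda>y. measure_pmf (p y)) \<in> measurable (count_space UNIV) (subprob_algebra (count_space UNIV))"
      by (simp add: measure_pmf_in_subprob_algebra)
    ultimately have "(\<lambda>w. measure_pmf (p (w m))) \<in> measurable (PiM {0..<Suc m} (\<lambda>_. count_space UNIV))
        (subprob_algebra (count_space UNIV))"
      by (rule measurable_compose)
    then show ?thesis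
      unfolding Suc by (simp add: markov_kernel_def[abs_def])
  qed
next
  case (2 i w)
  show ?case
    by (simp add: markov_kernel_def measure_pmf.prob_space_axioms)
qed

definition markov_law :: "('v \<Rightarrow> 'v pmf) \<Rightarrow> 'v \<Rightarrow> (nat \<Rightarrow> 'v) measure" where
  "markov_law p x = markov.PF.lim p x"

lemma sets_markov_law [measurable_cong]:
  "sets (markov_law p x) = sets (PiM UNIV (\<lambda>_. count_space UNIV))"
  by (simp add: markov_law_def)

lemma space_markov_law [simp]: "space (markov_law p x) = UNIV"
  using sets_eq_imp_space_eq[OF sets_markov_law] by (simp add: space_PiM PiE_def)

lemma prob_space_markov_law: "prob_space (markov_law p x)"
proof
  interpret CI: prob_space "markov.CI p x {}"
    by (rule markov.PF.prob_space_P) simp_all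
  have "emeasure (markov_law p x) (markov.PF.emb UNIV {} {\<lambda>_. undefined}) = markov.CI p x {} {\<lambda>_. undefined}"
    unfolding markov_law_def by (rule markov.lim) (auto simp: PiM_empty)
  moreover have "markov.PF.emb UNIV {} {\<lambda>_. undefined} = (UNIV :: (nat \<Rightarrow> 'a) set)"
    by (auto simp: prod_emb_def restrict_def)
  moreover have "markov.CI p x {} {\<lambda>_. undefined} = 1"
    using CI.emeasure_space_1 by (simp add: markov.CI_def space_PiM)
  ultimately show "emeasure (markov_law p x) (space (markov_law p x)) = 1"
    by simp
qed

lemma markov_law_cylinder:
  "emeasure (markov_law p x) {w. \<forall>i\<le>n. w i = u i} =
     (if u 0 = x then 1 else 0) * ennreal (\<Prod>i<n. pmf (p (u i)) (u (Suc i)))"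
proof -
  let ?M = "\<lambda>_ :: nat. count_space (UNIV :: 'a set)"
  define S where "S m = PiE {0..<m} (\<lambda>i. {u i})" for m :: nat
  have S [measurable]: "S m \<in> sets (PiM {0..<m} ?M)" for m
    unfolding S_def by (rule sets_PiM_I_finite) auto
  have sp: "(\<lambda>_. undefined) \<in> space (PiM {0..<0::nat} ?M)"
    by (simp add: space_PiM)
  have step: "emeasure (markov.C p x 0 (Suc m) (\<lambda>_. undefined)) (S (Suc m)) =
      emeasure (markov.C p x 0 m (\<lambda>_. undefined)) (S m) *
      ennreal (pmf (case m of 0 \<Rightarrow> return_pmf x | Suc k \<Rightarrow> p (u k)) (u m))" for m
  proof -
    have "emeasure (markov.C p x 0 (Suc m) (\<lambda>_. undefined)) (S (Suc m)) =
        (\<integral>\<^sup>+w. emeasure (markov.eP p x m w) (S (Suc m)) \<partial>markov.C p x 0 m (\<lambda>_. undefined))"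
      using markov.measurable_eP[of p x m] markov.sets_C[OF sp, of p x m]
        markov.space_C[OF sp, of p x m] S[of "Suc m"]
      by (simp only: markov.C.simps add_0, intro emeasure_bind[where N="PiM {0..<Suc m} ?M"])
         (auto simp: space_PiM prob_space.not_empty[OF markov.prob_space_C[OF sp]] cong: measurable_cong_sets)
    also have "\<dots> = (\<integral>\<^sup>+w. indicator (S m) w * ennreal (pmf (case m of 0 \<Rightarrow> return_pmf x | Suc k \<Rightarrow> p (u k)) (u m))
        \<partial>markov.C p x 0 m (\<lambda>_. undefined))"
    proof (rule nn_integral_cong)
      fix w assume "w \<in> space (markov.C p x 0 m (\<lambda>_. undefined))"
      then have w: "w \<in> space (PiM {0..<m} ?M)"
        using markov.space_C[OF sp, of p x m] by simp
      have "(\<lambda>y. w(m := y)) -` S (Suc m) = (if w \<in> S m then {u m} else {})"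
        using w by (auto simp: S_def space_PiM PiE_def Pi_def extensional_def less_Suc_eq)
      moreover have "w \<in> S m \<Longrightarrow> m = Suc k \<Longrightarrow> w k = u k" for k
        by (auto simp: S_def PiE_def Pi_def)
      ultimately show "emeasure (markov.eP p x m w) (S (Suc m)) =
          indicator (S m) w * ennreal (pmf (case m of 0 \<Rightarrow> return_pmf x | Suc k \<Rightarrow> p (u k)) (u m))"
        by (subst markov.emeasure_eP[OF w S])
           (auto simp: markov_kernel_def emeasure_pmf_single split: nat.split)
    qed
    also have "\<dots> = emeasure (markov.C p x 0 m (\<lambda>_. undefined)) (S m) *
        ennreal (pmf (case m of 0 \<Rightarrow> return_pmf x | Suc k \<Rightarrow> p (u k)) (u m))"
    proof (subst nn_integral_multc)
      have "S m \<in> sets (markov.C p x 0 m (\<lambda>_. undefined))"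
        using markov.sets_C[OF sp, of p x m] S[of m] by simp
      then show "indicator (S m) \<in> borel_measurable (markov.C p x 0 m (\<lambda>_. undefined))"
        and "(\<integral>\<^sup>+w. indicator (S m) w \<partial>markov.C p x 0 m (\<lambda>_. undefined)) * ennreal (pmf (case m of 0 \<Rightarrow> return_pmf x | Suc k \<Rightarrow> p (u k)) (u m)) =
          emeasure (markov.C p x 0 m (\<lambda>_. undefined)) (S m) * ennreal (pmf (case m of 0 \<Rightarrow> return_pmf x | Suc k \<Rightarrow> p (u k)) (u m))"
        by simp_all
    qed
    finally show ?thesis .
  qed
  have C: "emeasure (markov.C p x 0 (Suc m) (\<lambda>_. undefined)) (S (Suc m)) =
      (if u 0 = x then 1 else 0) * ennreal (\<Prod>i<m. pmf (p (u i)) (u (Suc i)))" for m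
  proof (induction m)
    case 0
    have "emeasure (markov.C p x 0 0 (\<lambda>_. undefined)) (S 0) = 1"
      using S[of 0] by (simp add: S_def)
    then show ?case
      by (subst step) auto
  next
    case (Suc m)
    show ?case
      by (subst step, subst Suc) (simp add: ennreal_mult prod_nonneg mult.assoc)
  qed
  have "{w. \<forall>i\<le>n. w i = u i} = markov.PF.emb UNIV {0..<Suc n} (S (Suc n))"
    by (auto simp: prod_emb_def S_def PiE_iff less_Suc_eq_le)
  then have "emeasure (markov_law p x) {w. \<forall>i\<le>n. w i = u i} = markov.CI p x {0..<Suc n} (S (Suc n))"
    unfolding markov_law_def by (simp only: markov.lim[OF _ S] finite_atLeastLessThan)
  also have "\<dots> = emeasure (markov.C p x 0 (Suc n) (\<lambda>_. undefined)) (S (Suc n))"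
    by (subst markov.emeasure_CI[OF subset_refl S])
       (simp add: prod_emb_id S_def PiE_iff extensional_def Pi_def)
  finally show ?thesis
    unfolding C .
qed

text \<open>
  The vertex set is the universe of a type of class \<^class>\<open>countable\<close> (finite or countably infinite).
\<close>

definition total_weight :: "'v set set \<Rightarrow> ('v \<Rightarrow> 'v \<Rightarrow> real) \<Rightarrow> 'v \<Rightarrow> real" where
  "total_weight E a x = (\<Sum>\<^sub>\<infinity>y\<in>{y. {x, y} \<in> E}. a x y)"

locale weighted_graph =
  fixes E :: "'v::countable set set" and a :: "'v \<Rightarrow> 'v \<Rightarrow> real"
  assumes edges: "E \<subseteq> {{x, y} |x y. x \<noteq> y}"
    and connected: "(x, y) \<in> {(x, y). {x, y} \<in> E}\<^sup>*"
    and weight_sym: "a x y = a y x"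
    and weight_nonneg: "0 \<le> a x y"
    and weight_pos_iff: "0 < a x y \<longleftrightarrow> {x, y} \<in> E"
    and weight_summable: "(\<lambda>y. a x y) summable_on {y. {x, y} \<in> E}"

text \<open>
  \<open>embed_pmf\<close> is applied to a genuine probability mass function (lemma \<open>pmf_walk_step\<close>) except on
  the one-vertex graph, where \<open>q(x,y) = 0 / 0\<close> is meaningless; there the only possible pmf makes the
  walk stay put, so that this graph is not transient.
\<close>

definition walk_step :: "'v set set \<Rightarrow> ('v \<Rightarrow> 'v \<Rightarrow> real) \<Rightarrow> 'v \<Rightarrow> 'v pmf" where
  "walk_step E a x = embed_pmf (\<lambda>y. a x y / total_weight E a x)"

abbreviation walk :: "'v set set \<Rightarrow> ('v \<Rightarrow> 'v \<Rightarrow> real) \<Rightarrow> 'v \<Rightarrow> (nat \<Rightarrow> 'v) measure" where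
  "walk E a \<equiv> markov_law (walk_step E a)"

lemma (in weighted_graph) pmf_walk_step:
  assumes "\<exists>z. z \<noteq> x"
  shows "pmf (walk_step E a x) y = a x y / total_weight E a x"
proof -
  let ?N = "{y. {x, y} \<in> E}"
  obtain z where "z \<noteq> x" using assms by blast
  with connected[of x z] obtain y0 where y0: "{x, y0} \<in> E"
    by (auto elim: converse_rtranclE)
  have hs: "(a x has_sum total_weight E a x) ?N"
    unfolding total_weight_def using weight_summable by (rule has_sum_infsum)
  have "a x y0 \<le> total_weight E a x"
  proof -
    have "sum (a x) {y0} \<le> total_weight E a x"
      using y0 weight_nonneg by (intro has_sum_mono_neutral[OF has_sum_finite[of "{y0}"] hs]) auto
    then show ?thesis by simp
  qed
  then have pos: "0 < total_weight E a x"
    using weight_pos_iff[of x y0] y0 by simp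
  have "(a x has_sum total_weight E a x) UNIV"
    using hs by (rule has_sum_cong_neutral[THEN iffD1, rotated -1])
       (use weight_pos_iff weight_nonneg in \<open>auto simp: order.order_iff_strict\<close>)
  then have "((\<lambda>y. a x y * inverse (total_weight E a x)) has_sum
      total_weight E a x * inverse (total_weight E a x)) UNIV"
    by (rule has_sum_cmult_left)
  then have *: "((\<lambda>y. a x y / total_weight E a x) has_sum 1) UNIV"
    using pos by (simp add: field_simps)
  have nonneg: "0 \<le> a x y / total_weight E a x" for y
    using pos weight_nonneg by simp
  have "(\<lambda>y. norm (a x y / total_weight E a x)) summable_on UNIV"
    by (rule summable_on_iff_abs_summable_on_real[THEN iffD1, OF has_sum_imp_summable[OF *]])
  note abs = this[unfolded abs_summable_equivalent]
  have "(\<integral>\<^sup>+y. ennreal (a x y / total_weight E a x) \<partial>count_space UNIV) = 1"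
    using nn_integral_conv_infsetsum[OF abs nonneg] infsetsum_infsum[OF abs] infsumI[OF *]
    by (simp only: ennreal_1)
  then show ?thesis
    unfolding walk_step_def using pos weight_nonneg
    by (intro pmf_embed_pmf) auto
qed

definition return_time :: "'v set \<Rightarrow> (nat \<Rightarrow> 'v) \<Rightarrow> enat" where
  "return_time K w = (INF n\<in>{n. 1 \<le> n \<and> w n \<in> K}. enat n)"

lemma return_time_eq_infinity_iff: "return_time K w = \<infinity> \<longleftrightarrow> (\<forall>n\<ge>1. w n \<notin> K)"
proof
  assume inf: "return_time K w = \<infinity>"
  show "\<forall>n\<ge>1. w n \<notin> K"
  proof (intro allI impI notI)
    fix n :: nat assume "1 \<le> n" "w n \<in> K"
    then have "return_time K w \<le> enat n"
      unfolding return_time_def by (intro INF_lower) auto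
    with inf show False by simp
  qed
next
  assume "\<forall>n\<ge>1. w n \<notin> K"
  then have "{n. 1 \<le> n \<and> w n \<in> K} = {}" by auto
  then show "return_time K w = \<infinity>"
    unfolding return_time_def by (simp only: image_empty Inf_empty top_enat_def)
qed

text \<open>
  From every vertex the walk has positive probability of never coming back.  The probability is
  taken on the full path space, since that \<open>walk E a x\<close> charges only \<open>W_plus E\<close> is a consequence of transience.
\<close>

definition transient :: "'v set set \<Rightarrow> ('v \<Rightarrow> 'v \<Rightarrow> real) \<Rightarrow> bool" where
  "transient E a \<longleftrightarrow> (\<forall>x. 0 < \<P>(w in walk E a x. return_time {x} w = \<infinity>))"

definition equilibrium :: "'v set set \<Rightarrow> ('v \<Rightarrow> 'v \<Rightarrow> real) \<Rightarrow> 'v set \<Rightarrow> 'v \<Rightarrow> real" where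
  "equilibrium E a K x =
     indicator K x * \<P>(w in walk E a x. return_time K w = \<infinity>) * total_weight E a x"

definition W_plus :: "'v set set \<Rightarrow> (nat \<Rightarrow> 'v) set" where
  "W_plus E = {w. (\<forall>n. {w n, w (Suc n)} \<in> E) \<and> (\<forall>y. finite {n. w n = y})}"

definition W_plus_space :: "'v set set \<Rightarrow> (nat \<Rightarrow> 'v) measure" where
  "W_plus_space E = sigma (W_plus E) {{w \<in> W_plus E. w n \<in> S} |n S. True}"

definition W :: "'v set set \<Rightarrow> (int \<Rightarrow> 'v) set" where
  "W E = {w. (\<forall>n. {w n, w (n + 1)} \<in> E) \<and> (\<forall>y. finite {n. w n = y})}"

definition W_space :: "'v set set \<Rightarrow> (int \<Rightarrow> 'v) measure" where
  "W_space E = sigma (W E) {{w \<in> W E. w n \<in> S} |n S. True}"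

definition shift_rel :: "'v set set \<Rightarrow> ((int \<Rightarrow> 'v) \<times> (int \<Rightarrow> 'v)) set" where
  "shift_rel E = {(w, w'). w \<in> W E \<and> w' \<in> W E \<and> (\<exists>k. w = (\<lambda>n. w' (n + k)))}"

definition W_star :: "'v set set \<Rightarrow> (int \<Rightarrow> 'v) set set" where
  "W_star E = W E // shift_rel E"

definition proj_star :: "'v set set \<Rightarrow> (int \<Rightarrow> 'v) \<Rightarrow> (int \<Rightarrow> 'v) set" where
  "proj_star E w = shift_rel E `` {w}"

text \<open>
  The generating family is already a sigma-algebra, see \<open>sets_W_star_space\<close>.
\<close>

definition W_star_space :: "'v set set \<Rightarrow> (int \<Rightarrow> 'v) set measure" where
  "W_star_space E =
     sigma (W_star E) {A. A \<subseteq> W_star E \<and> proj_star E -` A \<inter> W E \<in> sets (W_space E)}"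

definition W_hit :: "'v set set \<Rightarrow> 'v set \<Rightarrow> (int \<Rightarrow> 'v) set" where
  "W_hit E K = {w \<in> W E. \<exists>n. w n \<in> K}"

definition W_star_hit :: "'v set set \<Rightarrow> 'v set \<Rightarrow> (int \<Rightarrow> 'v) set set" where
  "W_star_hit E K = proj_star E ` W_hit E K"

lemma equiv_shift_rel: "equiv (W E) (shift_rel E)"
proof (rule equivI)
  show "shift_rel E \<subseteq> W E \<times> W E"
    by (auto simp: shift_rel_def)
  show "refl_on (W E) (shift_rel E)"
    by (auto simp: refl_on_def shift_rel_def intro!: exI[of _ 0])
  show "sym (shift_rel E)"
  proof (rule symI)
    fix w w' assume "(w, w') \<in> shift_rel E"
    then obtain k where k: "w \<in> W E" "w' \<in> W E" "w = (\<lambda>n. w' (n + k))"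
      by (auto simp: shift_rel_def)
    then have "w' = (\<lambda>n. w (n + (- k)))" by simp
    with k show "(w', w) \<in> shift_rel E"
      unfolding shift_rel_def by blast
  qed
  show "trans (shift_rel E)"
  proof (rule transI)
    fix u v w assume "(u, v) \<in> shift_rel E" "(v, w) \<in> shift_rel E"
    then obtain k l where k: "u \<in> W E" "w \<in> W E" "u = (\<lambda>n. v (n + k))" "v = (\<lambda>n. w (n + l))"
      by (auto simp: shift_rel_def)
    then have "u = (\<lambda>n. w (n + (k + l)))" by (simp add: add.assoc)
    with k show "(u, w) \<in> shift_rel E"
      unfolding shift_rel_def by blast
  qed
qed

lemma space_W_space [simp]: "space (W_space E) = W E"
  unfolding W_space_def by (rule space_measure_of) auto

lemma space_W_plus_space [simp]: "space (W_plus_space E) = W_plus E"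
  unfolding W_plus_space_def by (rule space_measure_of) auto

lemma space_W_star_space [simp]: "space (W_star_space E) = W_star E"
  unfolding W_star_space_def by (rule space_measure_of) auto

lemma sets_W_star_space:
  "sets (W_star_space E) =
     {A. A \<subseteq> W_star E \<and> proj_star E -` A \<inter> W E \<in> sets (W_space E)}" (is "_ = ?G")
proof -
  have proj: "proj_star E w \<in> W_star E" if "w \<in> W E" for w
    using that by (auto simp: proj_star_def W_star_def intro: quotientI)
  have "sigma_algebra (W_star E) ?G"
    unfolding sigma_algebra_iff2
  proof (intro conjI ballI allI impI)
    fix A assume A: "A \<in> ?G"
    have "proj_star E -` (W_star E - A) \<inter> W E = space (W_space E) - (proj_star E -` A \<inter> W E)"
      using proj by auto
    with A show "W_star E - A \<in> ?G"
      by (auto simp del: space_W_space)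
  next
    fix A :: "nat \<Rightarrow> _" assume A: "range A \<subseteq> ?G"
    have "(\<Union>i. proj_star E -` A i \<inter> W E) \<in> sets (W_space E)"
      using A by (intro sets.countable_UN) auto
    also have "(\<Union>i. proj_star E -` A i \<inter> W E) = proj_star E -` (\<Union>i. A i) \<inter> W E"
      by auto
    finally show "(\<Union>i. A i) \<in> ?G"
      using A by auto
  qed auto
  then show ?thesis
    unfolding W_star_space_def by (rule sigma_algebra.sets_measure_of_eq)
qed

text \<open>
  A real-valued \<^const>\<open>measure\<close> may be used since \<open>Q\<close> is finite.  Where the conditioning event has
  probability \<open>0\<close>, the equilibrium measure vanishes and so does the right-hand side.
\<close>

definition is_Q :: "'v set set \<Rightarrow> ('v \<Rightarrow> 'v \<Rightarrow> real) \<Rightarrow> 'v set \<Rightarrow> (int \<Rightarrow> 'v) measure \<Rightarrow> bool" where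
  "is_Q E a K Q \<longleftrightarrow>
     finite_measure Q \<and>
     sets Q = sets (restrict_space (W_space E) (W_hit E K)) \<and>
     (\<forall>A\<in>sets (W_plus_space E). \<forall>B\<in>sets (W_plus_space E). \<forall>x.
        measure Q {w \<in> W_hit E K. (\<lambda>n. w (- int n)) \<in> A \<and> w 0 = x \<and> (\<lambda>n. w (int n)) \<in> B} =
        \<P>(w in walk E a x. w \<in> A \<bar> return_time K w = \<infinity>)
          * equilibrium E a K x * \<P>(w in walk E a x. w \<in> B))"

definition Q_measure :: "'v set set \<Rightarrow> ('v \<Rightarrow> 'v \<Rightarrow> real) \<Rightarrow> 'v set \<Rightarrow> (int \<Rightarrow> 'v) measure" where
  "Q_measure E a K = (THE Q. is_Q E a K Q)"

end

theory Submission
  imports Defs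
begin

text \<open>
  All the measures \<open>Q_K\<close> are pieces of one measure on doubly infinite paths.  Let \<open>M\<close> be the
  \<sigma>-finite measure under which the position at time \<open>0\<close> has distribution \<open>\<mu>\<close> and, given
  \<open>X_0 = x\<close>, the past and the future are independent walks started at \<open>x\<close>; it is called
  \<open>stationary\<close> below.  Two observations prove the theorem.

  \<^item> A path that is in \<open>K\<close> at time \<open>0\<close> satisfies \<open>X_n \<notin> K\<close> for all \<open>n < 0\<close> precisely when its past,
    seen as a walk, never returns to \<open>K\<close>.  Therefore \<open>Q_K\<close>, which weights \<open>x \<in> K\<close> by
    \<open>e_K(x) = \<mu>_x P_x[no return to K]\<close> and conditions the past on no return, is \<open>M\<close> restricted
    to the paths of \<open>W\<close> that enter \<open>K\<close> for the first time at time \<open>0\<close>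
    (\<open>is_Q_entrance_measure\<close>).

  \<^item> \<open>M\<close> is invariant under time shifts, because the walk is reversible with respect to \<open>\<mu>\<close>
    (\<open>distr_stationary_translate_1\<close>).

  A rule that singles out exactly one time on each path, in a shift-equivariant way, selects one
  representative of each class modulo shift, namely the one whose distinguished time is \<open>0\<close>.
  Shift invariance of \<open>M\<close> makes the measure that \<open>M\<close> induces on shift-invariant events independent of
  the rule (\<open>mass_transport\<close>).  The first entrance into \<open>K\<close> is such a rule on the paths that hit
  \<open>K\<close>.  A rule on all of \<open>W\<close> is obtained from an enumeration of the vertices: take the first visit
  to the visited vertex of least index.  Pushing forward \<open>M\<close> restricted to the representatives of this
  second rule gives \<open>\<nu>\<close> directly, and comparing the two rules gives
  \<open>1_{W*_K} \<nu> = \<pi>* Q_K\<close> for every finite \<open>K\<close> (\<open>density_interlacement\<close>).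

  Uniqueness of \<open>Q_K\<close> is a \<pi>-\<lambda> argument over the events that prescribe the past, the position at time
  \<open>0\<close> and the future; uniqueness and \<sigma>-finiteness of \<open>\<nu>\<close> hold because \<open>W*\<close> is the increasing union of
  the \<open>W*_K\<close> over an exhaustion by finite sets.
\<close>

section \<open>Path spaces\<close>

abbreviation path_algebra :: "('i \<Rightarrow> 'v) measure" where
  "path_algebra \<equiv> PiM UNIV (\<lambda>_. count_space UNIV)"

abbreviation (input) past :: "(int \<Rightarrow> 'v) \<Rightarrow> nat \<Rightarrow> 'v" where
  "past w \<equiv> (\<lambda>n. w (- int n))"

abbreviation (input) future :: "(int \<Rightarrow> 'v) \<Rightarrow> nat \<Rightarrow> 'v" where
  "future w \<equiv> (\<lambda>n. w (int n))"

abbreviation (input) translate :: "int \<Rightarrow> (int \<Rightarrow> 'v) \<Rightarrow> int \<Rightarrow> 'v" where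
  "translate k w \<equiv> (\<lambda>n. w (n + k))"

definition glue :: "(nat \<Rightarrow> 'v) \<Rightarrow> (nat \<Rightarrow> 'v) \<Rightarrow> int \<Rightarrow> 'v" where
  "glue v w n = (if 0 \<le> n then w (nat n) else v (nat (- n)))"

lemma space_path_algebra [simp]: "space path_algebra = UNIV"
  by (simp add: space_PiM PiE_def)

lemma measurable_coordinate [measurable]:
  "(\<lambda>w. w i) \<in> measurable path_algebra (count_space UNIV)"
  by (rule measurable_component_singleton) simp

lemma UNIV_in_path_algebra [simp]: "UNIV \<in> sets path_algebra"
  using sets.top[of path_algebra] by simp

lemma coordinate_in_sets: "{w. w i \<in> S} \<in> sets path_algebra"
  using measurable_sets[OF measurable_coordinate, of S i] by (simp add: vimage_def)

lemma measurable_pathI: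
  assumes "\<And>i. (\<lambda>x. f x i) \<in> measurable N (count_space UNIV)"
  shows "f \<in> measurable N path_algebra"
proof -
  have "(\<lambda>x i. f x i) \<in> measurable N path_algebra"
    using assms by (intro measurable_PiM_single') auto
  then show ?thesis by simp
qed

lemma measurable_reindex: "(\<lambda>w i. w (g i)) \<in> measurable path_algebra path_algebra"
  by (rule measurable_pathI) measurable

lemma measurable_past: "past \<in> measurable path_algebra path_algebra"
  by (rule measurable_reindex)

lemma measurable_future: "future \<in> measurable path_algebra path_algebra"
  by (rule measurable_reindex)

lemma measurable_translate: "translate k \<in> measurable path_algebra path_algebra"
  by (rule measurable_reindex)

lemma translate_vimage_in_sets:
  "A \<in> sets path_algebra \<Longrightarrow> {w. translate k w \<in> A} \<in> sets path_algebra"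
  using measurable_sets[OF measurable_translate, of A k] by (simp add: vimage_def)

lemma measurable_glue [measurable]:
  "(\<lambda>(v, w). glue v w) \<in> measurable (path_algebra \<Otimes>\<^sub>M path_algebra) path_algebra"
proof (rule measurable_pathI)
  fix n :: int
  show "(\<lambda>x. (case x of (v, w) \<Rightarrow> glue v w) n)
      \<in> measurable (path_algebra \<Otimes>\<^sub>M path_algebra) (count_space UNIV)"
    using measurable_compose[OF measurable_snd measurable_coordinate]
      measurable_compose[OF measurable_fst measurable_coordinate]
    by (cases "0 \<le> n") (simp_all only: glue_def split_beta' if_True if_False)
qed

text \<open>
  For countably many vertices any relation between two coordinates is measurable, since it is a
  countable union of rectangles.
\<close>

lemma pred_two_coordinates:
  fixes R :: "'v::countable \<Rightarrow> 'v \<Rightarrow> bool"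
  shows "Measurable.pred path_algebra (\<lambda>w. R (w i) (w j))"
proof -
  have "(\<lambda>w. R (w i) (w j)) = (\<lambda>w. \<exists>x y. w i = x \<and> w j = y \<and> R x y)"
    by auto
  then show ?thesis by simp
qed

text \<open>
  The \<sigma>-algebras on \<open>W_plus\<close>, on \<open>W\<close> and on the trajectories that hit \<open>K\<close> are generated by the
  coordinates.  Identifying them with traces of the product \<sigma>-algebra lets the whole proof work with the product \<sigma>-algebra on all
  functions, where the laws of the walks live.
\<close>

lemma sets_sigma_coordinates:
  "sets (sigma \<Omega> {{w \<in> \<Omega>. w n \<in> S} |n S. True}) = sets (restrict_space path_algebra \<Omega>)"
proof -
  let ?G = "{{w. w n \<in> S} |(n :: 'a) (S :: 'b set). True}"
  have "sets (restrict_space path_algebra \<Omega>) = sets (vimage_algebra \<Omega> (\<lambda>w. w) path_algebra)"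
    by (rule restrict_space_eq_vimage_algebra) simp
  also have "\<dots> = sets (vimage_algebra \<Omega> (\<lambda>w. w) (sigma UNIV ?G))"
    by (rule sets_vimage_algebra_cong) (simp add: sets_PiM_single PiE_def)
  also have "\<dots> = sets (sigma \<Omega> {(\<lambda>w. w) -` A \<inter> \<Omega> |A. A \<in> ?G})"
    by (subst vimage_algebra_sigma) auto
  also have "{(\<lambda>w. w) -` A \<inter> \<Omega> |A. A \<in> ?G} = {{w \<in> \<Omega>. w n \<in> S} |n S. True}"
    by (simp add: setcompr_eq_image image_def) blast
  finally show ?thesis ..
qed

lemma W_plus_measurable [measurable]: "W_plus E \<in> sets path_algebra"
  for E :: "'v::countable set set"
proof -
  have "(\<forall>n\<in>{n. w n = y}. n \<le> N) \<longleftrightarrow> (\<forall>n>N. w n \<noteq> y)" for w :: "nat \<Rightarrow> 'v" and y N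
    using not_le by blast
  then have *: "finite {n. w n = y} \<longleftrightarrow> (\<exists>N. \<forall>n>N. w n \<noteq> y)" for w :: "nat \<Rightarrow> 'v" and y
    by (simp add: finite_nat_set_iff_bounded_le)
  have [measurable]: "Measurable.pred path_algebra (\<lambda>w. {w i, w j} \<in> E)" for i j :: nat
    by (rule pred_two_coordinates)
  have "W_plus E = {w \<in> space path_algebra. (\<forall>n. {w n, w (Suc n)} \<in> E) \<and> (\<forall>y. \<exists>N. \<forall>n>N. w n \<noteq> y)}"
    by (simp add: W_plus_def *)
  also have "\<dots> \<in> sets path_algebra"
    by measurable
  finally show ?thesis .
qed

text \<open>
  Read from time \<open>0\<close>, a doubly infinite path is a pair of one-sided ones; the adjacency and
  finiteness conditions split accordingly, because the edges are unordered pairs.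
\<close>

lemma W_iff_past_future: "w \<in> W E \<longleftrightarrow> past w \<in> W_plus E \<and> future w \<in> W_plus E"
proof -
  have edge: "(\<forall>n. {w n, w (n + 1)} \<in> E) \<longleftrightarrow>
      (\<forall>n. {w (- int n), w (- int (Suc n))} \<in> E) \<and> (\<forall>n. {w (int n), w (int (Suc n))} \<in> E)"
    (is "?L \<longleftrightarrow> ?R")
  proof
    assume ?L
    show ?R
    proof (intro conjI allI)
      fix n
      show "{w (- int n), w (- int (Suc n))} \<in> E"
        using \<open>?L\<close>[rule_format, of "- int (Suc n)"] by (simp add: insert_commute)
      show "{w (int n), w (int (Suc n))} \<in> E"
        using \<open>?L\<close>[rule_format, of "int n"] by (simp add: add.commute)
    qed
  next
    assume R: ?R
    show ?L
    proof
      fix n :: int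
      show "{w n, w (n + 1)} \<in> E"
      proof (cases "0 \<le> n")
        case True
        then show ?thesis using R[THEN conjunct2, rule_format, of "nat n"] by (simp add: add.commute)
      next
        case False
        then show ?thesis using R[THEN conjunct1, rule_format, of "nat (- n - 1)"]
          by (simp add: insert_commute add.commute)
      qed
    qed
  qed
  have fin: "finite {n. w n = y} \<longleftrightarrow> finite {n. w (- int n) = y} \<and> finite {n. w (int n) = y}" for y
  proof -
    have "{n. w n = y} = (\<lambda>n. - int n) ` {n. w (- int n) = y} \<union> int ` {n. w (int n) = y}"
    proof (intro set_eqI iffI)
      fix n assume "n \<in> {n. w n = y}"
      then show "n \<in> (\<lambda>n. - int n) ` {n. w (- int n) = y} \<union> int ` {n. w (int n) = y}"
        by (cases n rule: int_cases2) auto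
    qed auto
    then show ?thesis
      by (simp add: finite_image_iff inj_on_def)
  qed
  show ?thesis
    by (simp add: W_def W_plus_def edge fin) blast
qed

lemma W_measurable [measurable]: "W E \<in> sets path_algebra"
  for E :: "'v::countable set set"
proof -
  have "W E = (past -` W_plus E \<inter> space path_algebra) \<inter> (future -` W_plus E \<inter> space path_algebra)"
    by (auto simp: W_iff_past_future)
  also have "\<dots> \<in> sets path_algebra"
    by (intro sets.Int measurable_sets[OF measurable_past] measurable_sets[OF measurable_future]) simp_all
  finally show ?thesis .
qed

lemma translate_in_W_iff: "translate k w \<in> W E \<longleftrightarrow> w \<in> W E"
proof -
  have imp: "translate k w \<in> W E" if "w \<in> W E" for k and w :: "int \<Rightarrow> 'a"
  proof -
    have "{n. w (n + k) = y} = (\<lambda>n. n - k) ` {n. w n = y}" for y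
      by (force simp: image_iff)
    moreover have "{w (n + k), w (n + 1 + k)} \<in> E" for n
    proof -
      have "{w (n + k), w (n + k + 1)} \<in> E" using that by (auto simp: W_def)
      then show ?thesis by (simp add: ac_simps)
    qed
    ultimately show ?thesis using that by (simp add: W_def)
  qed
  show ?thesis
  proof
    assume "translate k w \<in> W E"
    from imp[OF this, of "- k"] show "w \<in> W E" by simp
  qed (rule imp)
qed

section \<open>The stationary two-sided walk\<close>

context weighted_graph
begin

lemma total_weight_nonneg: "0 \<le> total_weight E a x"
  unfolding total_weight_def by (rule infsum_nonneg) (simp add: weight_nonneg)

text \<open>
  On a graph with a single vertex the step distribution is not \<open>a x y / total_weight E a x\<close>, but there
  both sides vanish because \<open>E\<close> has no loops.
\<close>

lemma flow: "total_weight E a x * pmf (walk_step E a x) y = a x y"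
proof (cases "\<exists>z. z \<noteq> x")
  case True
  note step = pmf_walk_step[OF this]
  have "total_weight E a x \<noteq> 0"
  proof
    assume "total_weight E a x = 0"
    then have "set_pmf (walk_step E a x) = {}"
      by (simp add: set_pmf_eq step)
    then show False by (simp add: set_pmf_not_empty)
  qed
  then show ?thesis by (simp add: step)
next
  case False
  have "{x, z} \<notin> E" for z
  proof
    assume "{x, z} \<in> E"
    with edges obtain p q :: 'v where "p \<noteq> q" by blast
    with False show False by metis
  qed
  with weight_pos_iff[of x y] weight_nonneg[of x y] show ?thesis
    by (simp add: total_weight_def)
qed

lemma detailed_balance:
  "total_weight E a x * pmf (walk_step E a x) y = total_weight E a y * pmf (walk_step E a y) x"
  by (simp only: flow) (rule weight_sym)

definition two_sided :: "'v \<Rightarrow> (int \<Rightarrow> 'v) measure" where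
  "two_sided x = distr (walk E a x \<Otimes>\<^sub>M walk E a x) path_algebra (\<lambda>(v, w). glue v w)"

text \<open>
  A mixture of the two-sided walks by the measure \<open>total_weight E a\<close>, whose total mass is infinite
  in general; the mixture is therefore written out as a set function.
\<close>

definition stationary :: "(int \<Rightarrow> 'v) measure" where
  "stationary = measure_of UNIV (sets path_algebra)
     (\<lambda>S. \<integral>\<^sup>+x. ennreal (total_weight E a x) * emeasure (two_sided x) S \<partial>count_space UNIV)"

lemma sets_stationary [simp, measurable_cong]: "sets stationary = sets path_algebra"
  unfolding stationary_def
  using sets.sets_measure_of_eq[of "path_algebra :: (int \<Rightarrow> 'v) measure"] by simp

lemma space_stationary [simp]: "space stationary = UNIV"
  using sets_eq_imp_space_eq[OF sets_stationary] by simp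

lemma sets_two_sided [simp, measurable_cong]: "sets (two_sided x) = sets path_algebra"
  by (simp add: two_sided_def)

lemma emeasure_stationary:
  assumes "S \<in> sets path_algebra"
  shows "emeasure stationary S =
    (\<integral>\<^sup>+x. ennreal (total_weight E a x) * emeasure (two_sided x) S \<partial>count_space UNIV)"
  unfolding stationary_def
proof (rule emeasure_measure_of_sigma[OF _ _ _ assms])
  show "sigma_algebra UNIV (sets (path_algebra :: (int \<Rightarrow> 'v) measure))"
    using sets.sigma_algebra_axioms[of "path_algebra :: (int \<Rightarrow> 'v) measure"] by simp
  show "positive (sets path_algebra)
      (\<lambda>S. \<integral>\<^sup>+x. ennreal (total_weight E a x) * emeasure (two_sided x) S \<partial>count_space UNIV)"
    by (simp add: positive_def)
  show "countably_additive (sets path_algebra)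
      (\<lambda>S. \<integral>\<^sup>+x. ennreal (total_weight E a x) * emeasure (two_sided x) S \<partial>count_space UNIV)"
  proof (rule countably_additiveI)
    fix S :: "nat \<Rightarrow> (int \<Rightarrow> 'v) set"
    assume S: "range S \<subseteq> sets path_algebra" "disjoint_family S"
    have "(\<Sum>i. \<integral>\<^sup>+x. ennreal (total_weight E a x) * emeasure (two_sided x) (S i) \<partial>count_space UNIV)
        = (\<integral>\<^sup>+x. (\<Sum>i. ennreal (total_weight E a x) * emeasure (two_sided x) (S i)) \<partial>count_space UNIV)"
      by (rule nn_integral_suminf[symmetric]) simp
    also have "\<dots> = (\<integral>\<^sup>+x. ennreal (total_weight E a x) * emeasure (two_sided x) (\<Union>i. S i) \<partial>count_space UNIV)"
      using S by (intro nn_integral_cong) (simp add: suminf_emeasure)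
    finally show "(\<Sum>i. \<integral>\<^sup>+x. ennreal (total_weight E a x) * emeasure (two_sided x) (S i) \<partial>count_space UNIV)
        = (\<integral>\<^sup>+x. ennreal (total_weight E a x) * emeasure (two_sided x) (\<Union>i. S i) \<partial>count_space UNIV)" .
  qed
qed

lemma AE_walk_start: "AE w in walk E a x. w 0 = x"
proof -
  interpret prob_space "walk E a x" by (rule prob_space_markov_law)
  have "emeasure (walk E a x) {w. w 0 = x} = 1"
    using markov_law_cylinder[of "walk_step E a" x 0 "\<lambda>_. x"] by simp
  then have "AE w in walk E a x. w \<in> {w. w 0 = x}"
    by (intro AE_in_set_eq_1[THEN iffD2]) (use coordinate_in_sets[of 0 "{x}"] in \<open>simp_all add: measure_def sets_markov_law\<close>)
  then show ?thesis by simp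
qed

lemma past_future_measurable:
  assumes "A \<in> sets path_algebra" "B \<in> sets path_algebra"
  shows "{w. past w \<in> A \<and> w 0 = x \<and> future w \<in> B} \<in> sets path_algebra"
proof -
  have "{w. past w \<in> A \<and> w 0 = x \<and> future w \<in> B} = (past -` A \<inter> space path_algebra)
      \<inter> ({w \<in> space path_algebra. w 0 = x} \<inter> (future -` B \<inter> space path_algebra))"
    by auto
  also have "\<dots> \<in> sets path_algebra"
    by (intro sets.Int measurable_sets[OF measurable_past] measurable_sets[OF measurable_future] assms)
      measurable
  finally show ?thesis .
qed

lemma emeasure_two_sided:
  assumes A: "A \<in> sets path_algebra" and B: "B \<in> sets path_algebra"
  shows "emeasure (two_sided x) {w. past w \<in> A \<and> w 0 = y \<and> future w \<in> B}
    = emeasure (walk E a x) A * emeasure (walk E a x) B * indicator {y} x"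
proof -
  let ?P = "walk E a x"
  interpret prob_space ?P by (rule prob_space_markov_law)
  interpret pair: pair_sigma_finite ?P ?P ..
  let ?S = "{w. past w \<in> A \<and> w 0 = y \<and> future w \<in> B}"
  have glue: "(\<lambda>(v, w). glue v w) \<in> measurable (?P \<Otimes>\<^sub>M ?P) path_algebra"
    by measurable
  have past_glue: "past (glue v w) = v" "future (glue v w) = w" "glue v w 0 = w 0"
    if "v 0 = w 0" for v w :: "nat \<Rightarrow> 'v"
    using that by (auto simp: glue_def fun_eq_iff)
  \<comment> \<open>Gluing loses the initial value of the past, which agrees almost surely with that of the future.\<close>
  have "AE v in ?P. AE w in ?P. v 0 = x \<and> w 0 = x"
    using AE_walk_start by simp
  then have start: "AE p in ?P \<Otimes>\<^sub>M ?P. fst p 0 = x \<and> snd p 0 = x"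
    by (intro pair.AE_pair_measure) simp_all
  have "emeasure (two_sided x) ?S = emeasure (?P \<Otimes>\<^sub>M ?P) ((\<lambda>(v, w). glue v w) -` ?S \<inter> space (?P \<Otimes>\<^sub>M ?P))"
    unfolding two_sided_def using past_future_measurable[OF A B] by (rule emeasure_distr[OF glue])
  also have "\<dots> = emeasure (?P \<Otimes>\<^sub>M ?P) (if x = y then A \<times> B else {})"
  proof (rule emeasure_eq_AE)
    show "AE p in ?P \<Otimes>\<^sub>M ?P. p \<in> (\<lambda>(v, w). glue v w) -` ?S \<inter> space (?P \<Otimes>\<^sub>M ?P)
        \<longleftrightarrow> p \<in> (if x = y then A \<times> B else {})"
      using start by eventually_elim (auto simp: space_pair_measure past_glue)
    show "(\<lambda>(v, w). glue v w) -` ?S \<inter> space (?P \<Otimes>\<^sub>M ?P) \<in> sets (?P \<Otimes>\<^sub>M ?P)"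
      using past_future_measurable[OF A B] by (rule measurable_sets[OF glue])
    show "(if x = y then A \<times> B else {}) \<in> sets (?P \<Otimes>\<^sub>M ?P)"
      using A B by (auto simp: sets_markov_law)
  qed
  also have "\<dots> = emeasure ?P A * emeasure ?P B * indicator {y} x"
    using emeasure_pair_measure_Times[of A ?P B] A B by (cases "x = y") (simp_all add: sets_markov_law)
  finally show ?thesis .
qed

text \<open>
  This formula has the shape of the prescription for \<open>Q_K\<close>, and it contains all finite-dimensional
  distributions.
\<close>

lemma emeasure_stationary_past_future:
  assumes A: "A \<in> sets path_algebra" and B: "B \<in> sets path_algebra"
  shows "emeasure stationary {w. past w \<in> A \<and> w 0 = x \<and> future w \<in> B}
    = ennreal (total_weight E a x) * emeasure (walk E a x) A * emeasure (walk E a x) B"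
proof -
  have "emeasure stationary {w. past w \<in> A \<and> w 0 = x \<and> future w \<in> B}
    = (\<integral>\<^sup>+y. (ennreal (total_weight E a y) * emeasure (walk E a y) A * emeasure (walk E a y) B)
        * indicator {x} y \<partial>count_space UNIV)"
    by (simp add: emeasure_stationary past_future_measurable emeasure_two_sided A B mult.assoc)
  also have "\<dots> = ennreal (total_weight E a x) * emeasure (walk E a x) A * emeasure (walk E a x) B"
    by (subst nn_integral_indicator_singleton) simp_all
  finally show ?thesis .
qed

abbreviation step :: "'v \<Rightarrow> 'v \<Rightarrow> real" where
  "step x y \<equiv> pmf (walk_step E a x) y"

text \<open>
  The window may be asymmetric, since shifting a symmetric window makes it so; but it has to contain
  time \<open>0\<close>, where past and future are glued.
\<close>

lemma emeasure_stationary_window: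
  "emeasure stationary {w. \<forall>i\<in>{- int m..int n}. w i = u i} =
    ennreal (total_weight E a (u 0) * (\<Prod>i<m. step (u (- int i)) (u (- int (Suc i))))
      * (\<Prod>i<n. step (u (int i)) (u (int (Suc i)))))"
proof -
  let ?A = "\<lambda>m g. {v :: nat \<Rightarrow> 'v. \<forall>i\<le>m. v i = u (g i)}"
  have meas: "?A m g \<in> sets path_algebra" for m g
  proof -
    have "?A m g = {v \<in> space path_algebra. \<forall>i\<le>m. v i = u (g i)}" by simp
    also have "\<dots> \<in> sets path_algebra" by measurable
    finally show ?thesis .
  qed
  have "(\<forall>i\<in>{- int m..int n}. w i = u i) \<longleftrightarrow>
      (\<forall>i\<le>m. w (- int i) = u (- int i)) \<and> w 0 = u 0 \<and> (\<forall>i\<le>n. w (int i) = u (int i))" for w :: "int \<Rightarrow> 'v"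
  proof (intro iffI ballI)
    fix i assume *: "(\<forall>i\<le>m. w (- int i) = u (- int i)) \<and> w 0 = u 0 \<and> (\<forall>i\<le>n. w (int i) = u (int i))"
      and i: "i \<in> {- int m..int n}"
    show "w i = u i"
    proof (cases "0 \<le> i")
      case True
      with * i show ?thesis by (auto dest!: spec[of _ "nat i"])
    next
      case False
      with * i show ?thesis by (auto dest!: spec[of _ "nat (- i)"])
    qed
  qed auto
  then have "{w. \<forall>i\<in>{- int m..int n}. w i = u i}
      = {w. past w \<in> ?A m (\<lambda>i. - int i) \<and> w 0 = u 0 \<and> future w \<in> ?A n int}"
    by simp
  then show ?thesis
    using emeasure_stationary_past_future[OF meas[of m "\<lambda>i. - int i"] meas[of n int], of "u 0"]
    by (simp only:) (simp add: markov_law_cylinder[of _ _ _ "\<lambda>i. u (- int i)"]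
        markov_law_cylinder[of _ _ _ "\<lambda>i. u (int i)"]
        ennreal_mult total_weight_nonneg prod_nonneg del: of_nat_Suc)
qed

definition window :: "nat \<Rightarrow> (int \<Rightarrow> 'v) \<Rightarrow> (int \<Rightarrow> 'v) set" where
  "window m u = {w. \<forall>i\<in>{- int m..int m}. w i = u i}"

text \<open>
  Symmetric windows are nested, which makes the family stable under intersection.  Radius \<open>0\<close> is left
  out so that a window shifted by one step still contains time \<open>0\<close>.
\<close>

definition windows :: "(int \<Rightarrow> 'v) set set" where
  "windows = insert {} (range (\<lambda>(m, u). window (Suc m) u))"

lemma window_in_windows: "window (Suc m) u \<in> windows"
  unfolding windows_def by (auto intro!: image_eqI[of _ _ "(m, u)"])

lemma windowsE:
  assumes "A \<in> windows"
  obtains "A = {}" | m u where "A = window (Suc m) u"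
  using assms unfolding windows_def by auto

lemma window_Int_window:
  assumes "m \<le> n"
  shows "window m u \<inter> window n v \<in> {{}, window n v}"
proof (cases "\<forall>i\<in>{- int m..int m}. v i = u i")
  case True
  with assms have "window m u \<inter> window n v = window n v"
    by (auto simp: window_def)
  then show ?thesis by simp
next
  case False
  then obtain i where "i \<in> {- int m..int m}" "v i \<noteq> u i" by blast
  moreover from this assms have "i \<in> {- int n..int n}" by auto
  ultimately have "window m u \<inter> window n v = {}"
    unfolding window_def by fastforce
  then show ?thesis by simp
qed

lemma Int_stable_windows: "Int_stable windows"
proof (rule Int_stableI)
  have nested: "window (Suc m) u \<inter> window (Suc n) v \<in> windows" if "m \<le> n" for m n u v
    using window_Int_window[of "Suc m" "Suc n" u v] that window_in_windows[of n v]
    by (auto simp: windows_def)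
  fix A B assume "A \<in> windows" "B \<in> windows"
  then show "A \<inter> B \<in> windows"
  proof (elim windowsE)
    fix m n u v assume "A = window (Suc m) u" "B = window (Suc n) v"
    then show ?thesis
      using nested[of m n u v] nested[of n m v u] by (cases "m \<le> n") (simp_all add: Int_commute)
  qed (simp_all add: windows_def)
qed

text \<open>
  There are uncountably many functions \<open>u\<close>, but only countably many windows of a given radius; listing
  their values provides the countable index needed to write coordinate events as countable unions.
\<close>

definition window_of_list :: "nat \<Rightarrow> 'v list \<Rightarrow> (int \<Rightarrow> 'v) set" where
  "window_of_list m l = window m (\<lambda>i. l ! nat (i + int m))"

lemma in_window_of_list: "w \<in> window_of_list m (map w [- int m..int m])"
  by (auto simp: window_of_list_def window_def nth_upto)

lemma window_measurable: "window m u \<in> sets path_algebra"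
proof -
  have "window m u = (\<Inter>i\<in>{- int m..int m}. {w. w i \<in> {u i}})"
    by (auto simp: window_def)
  also have "\<dots> \<in> sets path_algebra"
    by (intro sets.finite_INT coordinate_in_sets) simp_all
  finally show ?thesis .
qed

lemma sets_path_algebra_windows: "sets path_algebra = sigma_sets UNIV windows"
proof (rule antisym)
  interpret S: sigma_algebra UNIV "sigma_sets UNIV windows"
    by (rule sigma_algebra_sigma_sets) simp
  have "{w. w i \<in> S} \<in> sigma_sets UNIV windows" for i S
  proof -
    define m where "m = Suc (nat \<bar>i\<bar>)"
    have "i \<in> {- int m..int m}"
      by (auto simp: m_def)
    then have val: "w i = l ! nat (i + int m)" if "w \<in> window_of_list m l" for l w
      using that by (simp add: window_of_list_def window_def)
    have "w i \<in> S \<longleftrightarrow> (\<exists>l\<in>{l. l ! nat (i + int m) \<in> S}. w \<in> window_of_list m l)" for w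
    proof
      assume "w i \<in> S"
      then show "\<exists>l\<in>{l. l ! nat (i + int m) \<in> S}. w \<in> window_of_list m l"
        using in_window_of_list[of w m] val[OF in_window_of_list[of w m]] by auto
    qed (auto dest: val)
    then have "{w. w i \<in> S} = (\<Union>l\<in>{l. l ! nat (i + int m) \<in> S}. window_of_list m l)"
      by blast
    also have "\<dots> \<in> sigma_sets UNIV windows"
      unfolding m_def window_of_list_def
      by (intro S.countable_UN'' sigma_sets.Basic window_in_windows countableI_type)
    finally show ?thesis .
  qed
  then have "{{f \<in> UNIV. f i \<in> A} |i A. True} \<subseteq> sigma_sets UNIV windows"
    by auto
  from S.sigma_sets_subset[OF this] show "sets path_algebra \<subseteq> sigma_sets UNIV windows"
    by (simp add: sets_PiM_single PiE_def)
  have "windows \<subseteq> sets path_algebra"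
    using window_measurable by (auto elim: windowsE)
  from sets.sigma_sets_subset[OF this] show "sigma_sets UNIV windows \<subseteq> sets path_algebra"
    by simp
qed

text \<open>
  Shifting by one step moves the origin of the product formula along one edge: the backward step
  from \<open>u 0\<close> to \<open>u (- 1)\<close> becomes a forward step from \<open>u (- 1)\<close> to \<open>u 0\<close>, and the reference weight moves
  from \<open>u 0\<close> to \<open>u (- 1)\<close>.  Detailed balance says that this does not change the product.  As windows of
  radius \<open>1\<close> have finite mass and cover the path space, agreement on windows suffices.
\<close>

lemma distr_stationary_translate_1: "distr stationary path_algebra (translate 1) = stationary"
proof (rule sym, rule measure_eqI_generator_eq[OF Int_stable_windows])
  have translate: "translate 1 \<in> measurable stationary path_algebra"
    using measurable_translate[of 1] by (simp cong: measurable_cong_sets)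
  fix X assume X: "X \<in> windows"
  then have "X \<in> sets path_algebra"
    by (simp add: sets_path_algebra_windows)
  then have distr: "emeasure (distr stationary path_algebra (translate 1)) X = emeasure stationary (translate 1 -` X)"
    using emeasure_distr[OF translate] by simp
  from X show "emeasure stationary X = emeasure (distr stationary path_algebra (translate 1)) X"
  proof (cases rule: windowsE)
    case (2 m u)
    let ?u = "\<lambda>i. u (i - 1)"
    have swap: "- int i - 1 = - 1 - int i" for i by simp
    have "(\<forall>i\<in>{- int (Suc m)..int (Suc m)}. w (i + 1) = u i)
      \<longleftrightarrow> (\<forall>i\<in>{- int m..int (Suc (Suc m))}. w i = ?u i)" for w :: "int \<Rightarrow> 'v"
    proof safe
      fix i assume "\<forall>i\<in>{- int (Suc m)..int (Suc m)}. w (i + 1) = u i" "i \<in> {- int m..int (Suc (Suc m))}"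
      then show "w i = u (i - 1)" by (auto dest!: bspec[of _ _ "i - 1"])
    next
      fix i assume "\<forall>i\<in>{- int m..int (Suc (Suc m))}. w i = ?u i" "i \<in> {- int (Suc m)..int (Suc m)}"
      then show "w (i + 1) = u i" by (auto dest!: bspec[of _ _ "i + 1"])
    qed
    then have "translate 1 -` X = {w. \<forall>i\<in>{- int m..int (Suc (Suc m))}. w i = ?u i}"
      unfolding 2 window_def by auto
    then have "emeasure (distr stationary path_algebra (translate 1)) X =
      ennreal (total_weight E a (u (- 1)) * (\<Prod>i<m. step (u (- int i - 1)) (u (- int (Suc i) - 1)))
      * (\<Prod>i<Suc (Suc m). step (u (int i - 1)) (u (int (Suc i) - 1))))"
      by (simp add: distr emeasure_stationary_window del: of_nat_Suc prod.lessThan_Suc)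
    also have "total_weight E a (u (- 1)) * (\<Prod>i<m. step (u (- int i - 1)) (u (- int (Suc i) - 1)))
        * (\<Prod>i<Suc (Suc m). step (u (int i - 1)) (u (int (Suc i) - 1)))
      = (total_weight E a (u (- 1)) * step (u (- 1)) (u 0)) * (\<Prod>i<m. step (u (- int i - 1)) (u (- int (Suc i) - 1)))
        * (\<Prod>i<Suc m. step (u (int i)) (u (int (Suc i))))"
      by (subst prod.lessThan_Suc_shift) (simp add: swap ac_simps del: prod.lessThan_Suc)
    also have "\<dots> = (total_weight E a (u 0) * step (u 0) (u (- 1))) * (\<Prod>i<m. step (u (- int i - 1)) (u (- int (Suc i) - 1)))
        * (\<Prod>i<Suc m. step (u (int i)) (u (int (Suc i))))"
      by (subst detailed_balance) (rule refl)
    also have "\<dots> = total_weight E a (u 0) * (\<Prod>i<Suc m. step (u (- int i)) (u (- int (Suc i))))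
      * (\<Prod>i<Suc m. step (u (int i)) (u (int (Suc i))))"
      by (subst prod.lessThan_Suc_shift[of "\<lambda>i. step (u (- int i)) (u (- int (Suc i)))"])
        (simp add: swap ac_simps del: prod.lessThan_Suc)
    also have "ennreal \<dots> = emeasure stationary X"
      unfolding 2 window_def by (rule emeasure_stationary_window[symmetric])
    finally show ?thesis ..
  qed simp
next
  let ?A = "\<lambda>k. window_of_list (Suc 0) (from_nat k)"
  show "range ?A \<subseteq> windows"
    using window_in_windows by (auto simp: window_of_list_def)
  have "w \<in> ?A (to_nat (map w [- int (Suc 0)..int (Suc 0)]))" for w
    using in_window_of_list[of w "Suc 0"] by simp
  then show "(\<Union>k. ?A k) = UNIV" by blast
  show "emeasure stationary (?A k) \<noteq> \<infinity>" for k
    unfolding window_of_list_def window_def by (subst emeasure_stationary_window) simp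
qed (simp_all add: sets_path_algebra_windows)

lemma emeasure_stationary_translate:
  assumes "S \<in> sets path_algebra"
  shows "emeasure stationary {w. translate k w \<in> S} = emeasure stationary S"
proof -
  have one: "emeasure stationary {w. translate 1 w \<in> S} = emeasure stationary S"
    if "S \<in> sets path_algebra" for S
  proof -
    have "emeasure (distr stationary path_algebra (translate 1)) S = emeasure stationary (translate 1 -` S \<inter> space stationary)"
      using measurable_translate[of 1] that by (intro emeasure_distr) (simp_all cong: measurable_cong_sets)
    then show ?thesis by (simp add: distr_stationary_translate_1 vimage_def)
  qed
  show ?thesis
  proof (induction k rule: int_induct[where k=0])
    case base
    then show ?case by simp
  next
    case (step1 i)
    have "{w. translate (i + 1) w \<in> S} = {w. translate 1 w \<in> {w. translate i w \<in> S}}"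
      by (simp add: ac_simps)
    then show ?case
      using trans[OF one[OF translate_vimage_in_sets[OF assms]] step1.IH] by (simp only:)
  next
    case (step2 i)
    have eq: "{w. translate 1 w \<in> {w. translate (i - 1) w \<in> S}} = {w. translate i w \<in> S}"
      by (simp add: ac_simps)
    have "emeasure stationary {w. translate (i - 1) w \<in> S}
        = emeasure stationary {w. translate 1 w \<in> {w. translate (i - 1) w \<in> S}}"
      by (rule one[OF translate_vimage_in_sets[OF assms], symmetric])
    also have "\<dots> = emeasure stationary S"
      unfolding eq by (rule step2.IH)
    finally show ?case .
  qed
qed

end


section \<open>Trajectories modulo time shift\<close>

lemma in_sets_W_space: "A \<in> sets (W_space E) \<longleftrightarrow> A \<subseteq> W E \<and> A \<in> sets path_algebra"
  for E :: "'v::countable set set"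
  unfolding W_space_def sets_sigma_coordinates by (rule sets_restrict_space_iff) simp

lemma in_sets_W_plus_space: "A \<in> sets (W_plus_space E) \<longleftrightarrow> A \<subseteq> W_plus E \<and> A \<in> sets path_algebra"
  for E :: "'v::countable set set"
  unfolding W_plus_space_def sets_sigma_coordinates by (rule sets_restrict_space_iff) simp

lemma W_hit_measurable: "W_hit E K \<in> sets path_algebra"
  for E :: "'v::countable set set"
proof -
  have "W_hit E K = W E \<inter> (\<Union>n. {w. w n \<in> K})"
    by (auto simp: W_hit_def)
  also have "\<dots> \<in> sets path_algebra"
    by (intro sets.Int W_measurable sets.countable_UN'' coordinate_in_sets) simp_all
  finally show ?thesis .
qed

lemma sets_restrict_W_hit:
  "sets (restrict_space (W_space E) (W_hit E K)) = sets (restrict_space path_algebra (W_hit E K))"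
  for E :: "'v::countable set set"
proof -
  have "W_hit E K \<subseteq> W E" by (auto simp: W_hit_def)
  then have "A \<in> sets (restrict_space (W_space E) (W_hit E K)) \<longleftrightarrow>
      A \<in> sets (restrict_space path_algebra (W_hit E K))" for A
    by (subst (1 2) sets_restrict_space_iff)
       (auto simp: in_sets_W_space W_hit_measurable Int_absorb2)
  then show ?thesis by blast
qed

lemma translate_in_W_hit_iff: "translate k w \<in> W_hit E K \<longleftrightarrow> w \<in> W_hit E K"
proof -
  have "(\<exists>n. w (n + k) \<in> K) \<longleftrightarrow> (\<exists>n. w n \<in> K)"
    by (metis diff_add_cancel)
  then show ?thesis by (simp add: W_hit_def translate_in_W_iff)
qed

lemma proj_star_translate:
  assumes "w \<in> W E"
  shows "proj_star E (translate k w) = proj_star E w"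
  unfolding proj_star_def
proof (rule equiv_class_eq[OF equiv_shift_rel])
  show "(translate k w, w) \<in> shift_rel E"
    using assms by (auto simp: shift_rel_def translate_in_W_iff)
qed

lemma proj_star_in_W_star: "w \<in> W E \<Longrightarrow> proj_star E w \<in> W_star E"
  by (auto simp: proj_star_def W_star_def intro: quotientI)

lemma proj_star_vimage_W_star_hit: "proj_star E -` W_star_hit E K \<inter> W E = W_hit E K"
proof (intro set_eqI iffI)
  fix w assume "w \<in> proj_star E -` W_star_hit E K \<inter> W E"
  then obtain w' where w: "w \<in> W E" "w' \<in> W_hit E K" "proj_star E w = proj_star E w'"
    by (auto simp: W_star_hit_def)
  then have "(w, w') \<in> shift_rel E"
    unfolding proj_star_def by (intro eq_equiv_class[OF _ equiv_shift_rel]) (auto simp: W_hit_def)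
  then obtain k where "w = translate k w'"
    by (auto simp: shift_rel_def)
  with w show "w \<in> W_hit E K"
    by (simp add: translate_in_W_hit_iff)
qed (auto simp: W_star_hit_def W_hit_def)

lemma in_sets_W_star_space:
  "A \<in> sets (W_star_space E) \<longleftrightarrow> A \<subseteq> W_star E \<and> proj_star E -` A \<inter> W E \<in> sets path_algebra"
  for E :: "'v::countable set set"
  by (auto simp: sets_W_star_space in_sets_W_space)

lemma W_star_hit_measurable: "W_star_hit E K \<in> sets (W_star_space E)"
  for E :: "'v::countable set set"
  unfolding in_sets_W_star_space proj_star_vimage_W_star_hit
  by (auto simp: W_hit_measurable W_star_hit_def W_hit_def intro: proj_star_in_W_star)

lemma measurable_proj_star:
  fixes E :: "'v::countable set set"
  assumes "\<Omega> \<subseteq> W E" "\<Omega> \<in> sets path_algebra" "sets M = sets (restrict_space path_algebra \<Omega>)"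
  shows "proj_star E \<in> measurable M (W_star_space E)"
proof (rule measurableI)
  have space: "space M = \<Omega>"
    using sets_eq_imp_space_eq[OF assms(3)] by (simp add: space_restrict_space)
  show "proj_star E w \<in> space (W_star_space E)" if "w \<in> space M" for w
    using that assms(1) by (auto simp: space intro: proj_star_in_W_star)
  fix A assume "A \<in> sets (W_star_space E)"
  then have "(proj_star E -` A \<inter> W E) \<inter> \<Omega> \<in> sets path_algebra"
    by (intro sets.Int[OF _ assms(2)]) (simp add: in_sets_W_star_space)
  moreover have "(proj_star E -` A \<inter> W E) \<inter> \<Omega> = proj_star E -` A \<inter> space M"
    using assms(1) by (auto simp: space)
  ultimately show "proj_star E -` A \<inter> space M \<in> sets M"
    using assms(2) by (simp add: assms(3) sets_restrict_space_iff space)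
qed

section \<open>Distinguished times and mass transport\<close>

definition first_entry :: "'v set set \<Rightarrow> 'v set \<Rightarrow> (int \<Rightarrow> 'v) set" where
  "first_entry E K = {w \<in> W E. w 0 \<in> K \<and> (\<forall>n<0. w n \<notin> K)}"

text \<open>
  The paths whose first visit to the visited vertex of least index takes place at time \<open>0\<close>.
\<close>

definition leader_entry :: "'v::countable set set \<Rightarrow> (int \<Rightarrow> 'v) set" where
  "leader_entry E = {w \<in> W E. (\<forall>n. to_nat (w 0) \<le> to_nat (w n)) \<and> (\<forall>n<0. w n \<noteq> w 0)}"

lemma ex1_first_time:
  fixes N :: "int set"
  assumes "finite N" "N \<noteq> {}"
  shows "\<exists>!k. k \<in> N \<and> (\<forall>n<0. n + k \<notin> N)"
proof (rule ex1I[of _ "Min N"])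
  have "n + Min N \<notin> N" if "n < 0" for n
    using Min_le[OF assms(1), of "n + Min N"] that by auto
  with assms show "Min N \<in> N \<and> (\<forall>n<0. n + Min N \<notin> N)" by simp
next
  fix k assume k: "k \<in> N \<and> (\<forall>n<0. n + k \<notin> N)"
  then have "Min N \<le> k" using assms by simp
  moreover have "\<not> Min N < k"
    using k[THEN conjunct2, rule_format, of "Min N - k"] assms by auto
  ultimately show "k = Min N" by simp
qed

lemma ex1_first_entry:
  assumes "finite K" "w \<in> W_hit E K"
  shows "\<exists>!k. translate k w \<in> first_entry E K"
proof -
  have w: "w \<in> W E" using assms by (simp add: W_hit_def)
  have "{n. w n \<in> K} = (\<Union>y\<in>K. {n. w n = y})" by auto
  then have "finite {n. w n \<in> K}"
    using assms(1) w by (simp add: W_def)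
  moreover have "{n. w n \<in> K} \<noteq> {}"
    using assms(2) by (auto simp: W_hit_def)
  ultimately have "\<exists>!k. k \<in> {n. w n \<in> K} \<and> (\<forall>n<0. n + k \<notin> {n. w n \<in> K})"
    by (rule ex1_first_time)
  then show ?thesis
    using w by (simp add: first_entry_def translate_in_W_iff)
qed

text \<open>
  A minimal index exists because \<open>to_nat\<close> takes values in a well-ordered set, and by injectivity it
  belongs to a single vertex.  That vertex is visited finitely often, so it has a first visit.
\<close>

lemma ex1_leader_entry:
  fixes E :: "'v::countable set set"
  assumes w: "w \<in> W E"
  shows "\<exists>!k. translate k w \<in> leader_entry E"
proof -
  obtain m where m: "\<And>n. to_nat (w m) \<le> to_nat (w n)"
    using ex_has_least_nat[of "\<lambda>_. True" 0 "\<lambda>n. to_nat (w n)"] by auto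
  have "(\<forall>n. to_nat (w k) \<le> to_nat (w (n + k))) \<longleftrightarrow> w k = w m" for k
  proof
    assume *: "\<forall>n. to_nat (w k) \<le> to_nat (w (n + k))"
    have "to_nat (w k) \<le> to_nat (w m)"
      using *[rule_format, of "m - k"] by simp
    with m[of k] show "w k = w m" by simp
  qed (simp add: m)
  then have "translate k w \<in> leader_entry E \<longleftrightarrow>
      k \<in> {n. w n = w m} \<and> (\<forall>n<0. n + k \<notin> {n. w n = w m})" for k
    using w by (auto simp: leader_entry_def translate_in_W_iff)
  moreover have "finite {n. w n = w m}" "{n. w n = w m} \<noteq> {}"
    using w by (auto simp: W_def)
  ultimately show ?thesis
    by (simp only:) (rule ex1_first_time)
qed

lemma first_entry_measurable: "first_entry E K \<in> sets path_algebra"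
  for E :: "'v::countable set set"
proof -
  have "first_entry E K = W E \<inter> ({w. w 0 \<in> K} \<inter> (\<Inter>n\<in>{..<0}. {w. w n \<in> - K}))"
    by (auto simp: first_entry_def)
  also have "\<dots> \<in> sets path_algebra"
    by (intro sets.Int W_measurable coordinate_in_sets sets.countable_INT'') simp_all
  finally show ?thesis .
qed

lemma leader_entry_measurable: "leader_entry E \<in> sets path_algebra"
  for E :: "'v::countable set set"
proof -
  have pair: "{w. R (w 0) (w n)} \<in> sets path_algebra" for R :: "'v \<Rightarrow> 'v \<Rightarrow> bool" and n :: int
    using pred_two_coordinates[of R 0 n] by (simp add: pred_def)
  have "leader_entry E = W E \<inter> ((\<Inter>n. {w. to_nat (w 0) \<le> to_nat (w n)}) \<inter> (\<Inter>n\<in>{..<0}. {w. w n \<noteq> w 0}))"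
    by (auto simp: leader_entry_def)
  also have "\<dots> \<in> sets path_algebra"
    by (intro sets.Int W_measurable sets.countable_INT'')
       (use pair[of "\<lambda>x y. to_nat x \<le> to_nat y"] pair[of "\<lambda>x y. y \<noteq> x"] in simp_all)
  finally show ?thesis .
qed

context weighted_graph
begin

text \<open>
  Let \<open>S\<close> and \<open>S'\<close> each mark exactly one time on every path of the shift-invariant event \<open>F\<close>.  Among
  the paths with \<open>S\<close>-mark at \<open>0\<close>, those with \<open>S'\<close>-mark at \<open>k\<close> are shifted by \<open>k\<close> onto the paths with
  \<open>S'\<close>-mark at \<open>0\<close> and \<open>S\<close>-mark at \<open>- k\<close>, which have the same mass.  Summing over \<open>k\<close> gives the total
  mass of the paths marked at \<open>0\<close> by \<open>S\<close> and by \<open>S'\<close>, respectively.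
\<close>

lemma mass_transport:
  assumes F: "F \<in> sets path_algebra" and invariant: "\<And>k w. translate k w \<in> F \<longleftrightarrow> w \<in> F"
    and S: "S \<in> sets path_algebra" "\<And>w. w \<in> F \<Longrightarrow> \<exists>!k. translate k w \<in> S"
    and S': "S' \<in> sets path_algebra" "\<And>w. w \<in> F \<Longrightarrow> \<exists>!k. translate k w \<in> S'"
  shows "emeasure stationary (F \<inter> S) = emeasure stationary (F \<inter> S')"
proof -
  let ?X = "\<lambda>k. F \<inter> S \<inter> {w. translate k w \<in> S'}"
  let ?Y = "\<lambda>k. F \<inter> S' \<inter> {w. translate (- k) w \<in> S}"
  have X: "?X k \<in> sets path_algebra" and Y: "?Y k \<in> sets path_algebra" for k
    by (intro sets.Int F S(1) S'(1) translate_vimage_in_sets)+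
  have unique: "i = j" if "w \<in> F" "translate i w \<in> S \<and> translate j w \<in> S \<or> translate i w \<in> S' \<and> translate j w \<in> S'" for i j w
    using S(2)[OF that(1)] S'(2)[OF that(1)] that(2) by blast
  have "F \<inter> S = (\<Union>k. ?X k)"
    using S'(2) by blast
  then have "emeasure stationary (F \<inter> S) = emeasure stationary (\<Union>k. ?X k)"
    by (rule arg_cong)
  also have "\<dots> = (\<integral>\<^sup>+k. emeasure stationary (?X k) \<partial>count_space UNIV)"
  proof (rule emeasure_UN_countable)
    show "disjoint_family_on ?X UNIV"
      using unique by (auto simp: disjoint_family_on_def)
  qed (use X in simp_all)
  also have "\<dots> = (\<integral>\<^sup>+k. emeasure stationary (?Y k) \<partial>count_space UNIV)"
  proof (rule nn_integral_cong)
    fix k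
    have cancel: "n + - k + k = n" for n :: int by simp
    have "{w. translate k w \<in> ?Y k} = ?X k"
      unfolding Int_iff mem_Collect_eq invariant cancel by blast
    then show "emeasure stationary (?X k) = emeasure stationary (?Y k)"
      using emeasure_stationary_translate[OF Y, of k k] by (simp only:)
  qed
  also have "\<dots> = emeasure stationary (\<Union>k. ?Y k)"
  proof (rule emeasure_UN_countable[symmetric])
    show "disjoint_family_on ?Y UNIV"
      using unique[of _ "- i" "- j" for i j] by (auto simp: disjoint_family_on_def)
  qed (use Y in simp_all)
  also have "(\<Union>k. ?Y k) = F \<inter> S'"
  proof -
    have "\<exists>k. translate (- k) w \<in> S" if "w \<in> F" for w
    proof -
      from S(2)[OF that] obtain k where "translate k w \<in> S" by blast
      then have "translate (- (- k)) w \<in> S" by simp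
      then show ?thesis by (rule exI)
    qed
    then show ?thesis by blast
  qed
  finally show ?thesis .
qed

section \<open>Entrance measures and the interlacement measure\<close>

definition entrance_measure :: "'v set \<Rightarrow> (int \<Rightarrow> 'v) measure" where
  "entrance_measure K = restrict_space (density stationary (indicator (first_entry E K))) (W_hit E K)"

text \<open>
  The intensity measure of random interlacements.  Each class modulo shift is represented by its
  member in \<open>leader_entry E\<close>, so that the push-forward counts the class once.
\<close>

definition interlacement :: "(int \<Rightarrow> 'v) set measure" where
  "interlacement = distr (restrict_space (density stationary (indicator (leader_entry E))) (W E))
     (W_star_space E) (proj_star E)"

lemma emeasure_restrict_density:
  assumes "S \<in> sets path_algebra" "\<Omega> \<in> sets path_algebra" "A \<in> sets path_algebra" "A \<subseteq> \<Omega>"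
  shows "emeasure (restrict_space (density stationary (indicator S)) \<Omega>) A = emeasure stationary (S \<inter> A)"
  using assms by (simp add: emeasure_restrict_space emeasure_restricted)

lemma sets_restrict_density:
  "sets (restrict_space (density stationary f) \<Omega>) = sets (restrict_space path_algebra \<Omega>)"
  by (rule sets_restrict_space_cong) simp

lemma emeasure_interlacement:
  assumes "A \<in> sets (W_star_space E)"
  shows "emeasure interlacement A = emeasure stationary (leader_entry E \<inter> (proj_star E -` A \<inter> W E))"
proof -
  let ?M = "restrict_space (density stationary (indicator (leader_entry E))) (W E)"
  have "emeasure interlacement A = emeasure ?M (proj_star E -` A \<inter> space ?M)"
    unfolding interlacement_def
    by (rule emeasure_distr[OF measurable_proj_star[OF subset_refl W_measurable sets_restrict_density] assms])
  also have "space ?M = W E"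
    by (simp add: space_restrict_space)
  finally show ?thesis
    using assms by (simp add: emeasure_restrict_density leader_entry_measurable in_sets_W_star_space)
qed

lemma emeasure_distr_entrance_measure:
  assumes "A \<in> sets (W_star_space E)"
  shows "emeasure (distr (entrance_measure K) (W_star_space E) (proj_star E)) A
    = emeasure stationary (first_entry E K \<inter> (proj_star E -` A \<inter> W_hit E K))"
proof -
  have hit: "W_hit E K \<subseteq> W E" by (auto simp: W_hit_def)
  then have "proj_star E -` A \<inter> W_hit E K = (proj_star E -` A \<inter> W E) \<inter> W_hit E K" by auto
  then have meas: "proj_star E -` A \<inter> W_hit E K \<in> sets path_algebra"
    using assms by (simp only:) (rule sets.Int[OF _ W_hit_measurable], simp add: in_sets_W_star_space)
  have "emeasure (distr (entrance_measure K) (W_star_space E) (proj_star E)) A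
      = emeasure (entrance_measure K) (proj_star E -` A \<inter> space (entrance_measure K))"
    unfolding entrance_measure_def
    by (rule emeasure_distr[OF measurable_proj_star[OF hit W_hit_measurable sets_restrict_density] assms])
  also have "space (entrance_measure K) = W_hit E K"
    by (simp add: entrance_measure_def space_restrict_space)
  finally show ?thesis
    using meas by (simp add: entrance_measure_def emeasure_restrict_density first_entry_measurable W_hit_measurable)
qed

text \<open>
  On trajectories that hit \<open>K\<close> the first entrance into \<open>K\<close> and the first visit to the leading vertex are
  both distinguished times, so mass transport identifies the two measures.
\<close>

lemma density_interlacement:
  assumes "finite K"
  shows "density interlacement (indicator (W_star_hit E K))
    = distr (entrance_measure K) (W_star_space E) (proj_star E)"
proof (rule measure_eqI)
  show "sets (density interlacement (indicator (W_star_hit E K)))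
      = sets (distr (entrance_measure K) (W_star_space E) (proj_star E))"
    by (simp add: interlacement_def)
  fix A assume "A \<in> sets (density interlacement (indicator (W_star_hit E K)))"
  then have A: "A \<in> sets (W_star_space E)" by (simp add: interlacement_def)
  let ?F = "proj_star E -` A \<inter> W_hit E K"
  have F_eq: "?F = (proj_star E -` A \<inter> W E) \<inter> W_hit E K"
    by (auto simp: W_hit_def)
  have F: "?F \<in> sets path_algebra"
    unfolding F_eq using A by (intro sets.Int[OF _ W_hit_measurable]) (simp add: in_sets_W_star_space)
  have invariant: "translate k w \<in> ?F \<longleftrightarrow> w \<in> ?F" for k w
  proof -
    have "w \<in> W_hit E K \<Longrightarrow> w \<in> W E" by (simp add: W_hit_def)
    then show ?thesis
      by (auto simp: translate_in_W_hit_iff proj_star_translate)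
  qed
  have "emeasure (density interlacement (indicator (W_star_hit E K))) A
      = emeasure interlacement (W_star_hit E K \<inter> A)"
    using A by (intro emeasure_restricted) (simp_all add: interlacement_def W_star_hit_measurable)
  also have "\<dots> = emeasure stationary (leader_entry E \<inter> (proj_star E -` (W_star_hit E K \<inter> A) \<inter> W E))"
    using A by (intro emeasure_interlacement sets.Int W_star_hit_measurable)
  also have "leader_entry E \<inter> (proj_star E -` (W_star_hit E K \<inter> A) \<inter> W E) = ?F \<inter> leader_entry E"
    using proj_star_vimage_W_star_hit[of E K] by blast
  also have "emeasure stationary (?F \<inter> leader_entry E) = emeasure stationary (?F \<inter> first_entry E K)"
  proof (rule mass_transport[OF F invariant leader_entry_measurable _ first_entry_measurable])
    fix w assume "w \<in> ?F"
    then show "\<exists>!k. translate k w \<in> leader_entry E" "\<exists>!k. translate k w \<in> first_entry E K"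
      using ex1_leader_entry[of w E] ex1_first_entry[OF assms, of w E] by (simp_all add: W_hit_def)
  qed
  also have "\<dots> = emeasure (distr (entrance_measure K) (W_star_space E) (proj_star E)) A"
    by (simp add: emeasure_distr_entrance_measure[OF A] Int_commute)
  finally show "emeasure (density interlacement (indicator (W_star_hit E K))) A
    = emeasure (distr (entrance_measure K) (W_star_space E) (proj_star E)) A" .
qed

lemma finite_entrance_measure:
  assumes "finite K"
  shows "finite_measure (entrance_measure K)"
proof (rule finite_measureI)
  have "first_entry E K \<inter> W_hit E K \<subseteq> (\<Union>x\<in>K. {w. w 0 \<in> {x}})"
    by (auto simp: first_entry_def)
  then have "emeasure (entrance_measure K) (space (entrance_measure K))
      \<le> emeasure stationary (\<Union>x\<in>K. {w. w 0 \<in> {x}})"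
    using assms
    by (simp add: entrance_measure_def space_restrict_space emeasure_restrict_density
        first_entry_measurable W_hit_measurable)
       (intro emeasure_mono, auto intro!: sets.finite_UN coordinate_in_sets[of 0 "{_}", simplified])
  also have "\<dots> \<le> (\<Sum>x\<in>K. emeasure stationary {w. w 0 \<in> {x}})"
    using assms by (intro emeasure_subadditive_finite) (auto intro: coordinate_in_sets[of 0 "{_}", simplified])
  also have "\<dots> < \<infinity>"
  proof -
    have "emeasure stationary {w. w 0 = x} < \<infinity>" for x
      using emeasure_stationary_past_future[of UNIV UNIV x] sets.top[of "path_algebra :: (nat \<Rightarrow> 'v) measure"]
        prob_space.emeasure_space_1[OF prob_space_markov_law, of "walk_step E a" x]
      by simp
    with assms show ?thesis by (simp add: ennreal_sum_less_top)
  qed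
  finally show "emeasure (entrance_measure K) (space (entrance_measure K)) \<noteq> \<infinity>" by simp
qed

section \<open>Characterisation of the entrance measures\<close>

definition cell :: "'v set \<Rightarrow> (nat \<Rightarrow> 'v) set \<Rightarrow> 'v \<Rightarrow> (nat \<Rightarrow> 'v) set \<Rightarrow> (int \<Rightarrow> 'v) set" where
  "cell K A x B = {w \<in> W_hit E K. past w \<in> A \<and> w 0 = x \<and> future w \<in> B}"

text \<open>
  The conditional probability times \<open>e_K(x)\<close> is \<open>\<mu>_x P_x[A, no return to K]\<close>; where the conditioning
  event is null this holds because both sides are zero.  No mass of \<open>cell K A x B\<close> is lost by
  restricting to paths in \<open>W\<close>, since \<open>A\<close> and \<open>B\<close> consist of paths in \<open>W_plus\<close>.
\<close>

lemma measure_entrance_cell: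
  assumes A: "A \<in> sets (W_plus_space E)" and B: "B \<in> sets (W_plus_space E)"
  shows "measure (entrance_measure K) (cell K A x B) =
    \<P>(w in walk E a x. w \<in> A \<bar> return_time K w = \<infinity>) * equilibrium E a K x * \<P>(w in walk E a x. w \<in> B)"
proof -
  interpret P: prob_space "walk E a x" by (rule prob_space_markov_law)
  let ?R = "{v :: nat \<Rightarrow> 'v. \<forall>n\<ge>1. v n \<notin> K}"
  have AB: "A \<in> sets path_algebra" "B \<in> sets path_algebra" "A \<subseteq> W_plus E" "B \<subseteq> W_plus E"
    using A B by (simp_all add: in_sets_W_plus_space)
  have "?R = (\<Inter>n\<in>{1..}. {v. v n \<in> - K})" by auto
  also have "\<dots> \<in> sets path_algebra"
    by (intro sets.countable_INT'' coordinate_in_sets) simp_all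
  finally have R: "?R \<in> sets path_algebra" .
  have cell: "cell K A x B = {w. past w \<in> A \<and> w 0 = x \<and> future w \<in> B} \<inter> W_hit E K"
    by (auto simp: cell_def)
  have "emeasure (entrance_measure K) (cell K A x B) = emeasure stationary (first_entry E K \<inter> cell K A x B)"
    unfolding entrance_measure_def cell
    by (intro emeasure_restrict_density first_entry_measurable W_hit_measurable sets.Int past_future_measurable AB) auto
  also have "first_entry E K \<inter> cell K A x B
      = (if x \<in> K then {w. past w \<in> A \<inter> ?R \<and> w 0 = x \<and> future w \<in> B} else {})"
  proof -
    have "(\<forall>n<0. w n \<notin> K) \<longleftrightarrow> past w \<in> ?R" for w
    proof
      assume *: "past w \<in> ?R"
      show "\<forall>n<0. w n \<notin> K"
      proof (intro allI impI)
        fix n :: int assume "n < 0"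
        with * show "w n \<notin> K" by (auto dest!: spec[of _ "nat (- n)"])
      qed
    qed auto
    moreover have "w \<in> W E" if "past w \<in> A" "future w \<in> B" for w
      using that AB by (auto simp: W_iff_past_future)
    ultimately show ?thesis
      by (auto simp: first_entry_def cell_def W_hit_def)
  qed
  also have "emeasure stationary \<dots> = indicator K x * (ennreal (total_weight E a x) * emeasure (walk E a x) (A \<inter> ?R) * emeasure (walk E a x) B)"
    using emeasure_stationary_past_future[OF sets.Int[OF AB(1) R] AB(2), of x] by (auto simp del: Int_iff)
  also have "\<dots> = ennreal (indicator K x * (total_weight E a x * measure (walk E a x) (A \<inter> ?R) * measure (walk E a x) B))"
    by (simp add: P.emeasure_eq_measure ennreal_mult total_weight_nonneg split: split_indicator)
  finally have "measure (entrance_measure K) (cell K A x B)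
      = indicator K x * (total_weight E a x * measure (walk E a x) (A \<inter> ?R) * measure (walk E a x) B)"
    by (simp add: measure_def total_weight_nonneg)
  moreover have "measure (walk E a x) (A \<inter> ?R) = 0" if "measure (walk E a x) ?R = 0"
    using P.finite_measure_mono[of "A \<inter> ?R" ?R] R that by (simp add: sets_markov_law measure_le_0_iff)
  ultimately show ?thesis
    by (simp add: cond_prob_def equilibrium_def return_time_eq_infinity_iff Int_def)
qed

lemma is_Q_iff:
  "is_Q E a K Q \<longleftrightarrow> finite_measure Q \<and> sets Q = sets (restrict_space path_algebra (W_hit E K)) \<and>
     (\<forall>A\<in>sets (W_plus_space E). \<forall>B\<in>sets (W_plus_space E). \<forall>x.
        measure Q (cell K A x B) = measure (entrance_measure K) (cell K A x B))"
  unfolding is_Q_def sets_restrict_W_hit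
  by (simp add: measure_entrance_cell) (simp add: cell_def)

lemma is_Q_entrance_measure: "finite K \<Longrightarrow> is_Q E a K (entrance_measure K)"
  by (simp add: is_Q_iff finite_entrance_measure) (simp add: entrance_measure_def sets_restrict_density)

definition cells :: "'v set \<Rightarrow> (int \<Rightarrow> 'v) set set" where
  "cells K = {cell K A x B |A x B. A \<in> sets (W_plus_space E) \<and> B \<in> sets (W_plus_space E)}"

lemma cell_in_cells:
  "A \<in> sets (W_plus_space E) \<Longrightarrow> B \<in> sets (W_plus_space E) \<Longrightarrow> cell K A x B \<in> cells K"
  by (auto simp: cells_def)

lemma Int_stable_cells: "Int_stable (cells K)"
proof (rule Int_stableI)
  fix C D assume "C \<in> cells K" "D \<in> cells K"
  then obtain A x B A' x' B' where C: "C = cell K A x B" "A \<in> sets (W_plus_space E)" "B \<in> sets (W_plus_space E)"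
    and D: "D = cell K A' x' B'" "A' \<in> sets (W_plus_space E)" "B' \<in> sets (W_plus_space E)"
    by (auto simp: cells_def)
  have "C \<inter> D = cell K (if x = x' then A \<inter> A' else {}) x (B \<inter> B')"
    by (auto simp: C D cell_def)
  also have "\<dots> \<in> cells K"
    using C D by (intro cell_in_cells) auto
  finally show "C \<inter> D \<in> cells K" .
qed

lemma UN_cell: "(\<Union>x. cell K (W_plus E) x (W_plus E)) = W_hit E K"
  by (auto simp: cell_def W_hit_def W_iff_past_future)

text \<open>
  A coordinate is read off from the future or from the past according to the sign of its index; the
  union over the position at time \<open>0\<close> is countable.
\<close>

lemma sets_restrict_W_hit_cells:
  "sets (restrict_space path_algebra (W_hit E K)) = sigma_sets (W_hit E K) (cells K)"
proof (rule antisym)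
  have cells: "cells K \<subseteq> Pow (W_hit E K)"
    by (auto simp: cells_def cell_def)
  interpret S: sigma_algebra "W_hit E K" "sigma_sets (W_hit E K) (cells K)"
    using cells by (rule sigma_algebra_sigma_sets)
  have top: "W_plus E \<in> sets (W_plus_space E)"
    by (simp add: in_sets_W_plus_space)
  have coord: "{v \<in> W_plus E. v n \<in> S} \<in> sets (W_plus_space E)" for n S
    using sets.Int[OF W_plus_measurable coordinate_in_sets, of E n S]
    by (auto simp: in_sets_W_plus_space Int_def)
  have "{w \<in> W_hit E K. w n \<in> S} \<in> sigma_sets (W_hit E K) (cells K)" for n S
  proof -
    define A where "A = (if n \<ge> 0 then W_plus E else {v \<in> W_plus E. v (nat (- n)) \<in> S})"
    define B where "B = (if n \<ge> 0 then {v \<in> W_plus E. v (nat n) \<in> S} else W_plus E)"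
    have "{w \<in> W_hit E K. w n \<in> S} = (\<Union>x. cell K A x B)"
      by (auto simp: cell_def A_def B_def W_hit_def W_iff_past_future)
    also have "\<dots> \<in> sigma_sets (W_hit E K) (cells K)"
      using top coord unfolding A_def B_def
      by (intro S.countable_UN'' sigma_sets.Basic cell_in_cells) auto
    finally show ?thesis .
  qed
  then have "{{w \<in> W_hit E K. w n \<in> S} |n S. True} \<subseteq> sigma_sets (W_hit E K) (cells K)"
    by auto
  from S.sigma_sets_subset[OF this]
  show "sets (restrict_space path_algebra (W_hit E K)) \<subseteq> sigma_sets (W_hit E K) (cells K)"
    unfolding sets_sigma_coordinates[symmetric] by (subst sets_measure_of) auto
  have "cell K A x B \<in> sets (restrict_space path_algebra (W_hit E K))"
    if "A \<in> sets (W_plus_space E)" "B \<in> sets (W_plus_space E)" for A x B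
  proof -
    have "cell K A x B = {w. past w \<in> A \<and> w 0 = x \<and> future w \<in> B} \<inter> W_hit E K"
      by (auto simp: cell_def)
    moreover have "A \<in> sets path_algebra" "B \<in> sets path_algebra"
      using that by (simp_all add: in_sets_W_plus_space)
    ultimately have "cell K A x B \<in> sets path_algebra"
      by (simp only:) (intro sets.Int past_future_measurable W_hit_measurable)
    moreover have "cell K A x B \<subseteq> W_hit E K"
      by (auto simp: cell_def)
    ultimately show ?thesis
      by (subst sets_restrict_space_iff) (simp_all add: W_hit_measurable)
  qed
  then have "cells K \<subseteq> sets (restrict_space path_algebra (W_hit E K))"
    by (auto simp: cells_def)
  from sets.sigma_sets_subset[OF this]
  show "sigma_sets (W_hit E K) (cells K) \<subseteq> sets (restrict_space path_algebra (W_hit E K))"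
    by (simp add: space_restrict_space)
qed

lemma is_Q_unique:
  assumes "finite K" "is_Q E a K Q"
  shows "Q = entrance_measure K"
proof (rule measure_eqI_generator_eq[OF Int_stable_cells])
  interpret Q: finite_measure Q using assms by (simp add: is_Q_iff)
  interpret R: finite_measure "entrance_measure K" by (rule finite_entrance_measure) fact
  show "cells K \<subseteq> Pow (W_hit E K)"
    by (auto simp: cells_def cell_def)
  show "emeasure Q X = emeasure (entrance_measure K) X" if "X \<in> cells K" for X
    using that assms by (auto simp: cells_def is_Q_iff Q.emeasure_eq_measure R.emeasure_eq_measure)
  show "sets Q = sigma_sets (W_hit E K) (cells K)" "sets (entrance_measure K) = sigma_sets (W_hit E K) (cells K)"
    using assms is_Q_entrance_measure[of K] by (simp_all add: is_Q_iff sets_restrict_W_hit_cells)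
  let ?A = "\<lambda>n. cell K (W_plus E) (from_nat n) (W_plus E)"
  show "range ?A \<subseteq> cells K"
    using cell_in_cells by (auto simp: in_sets_W_plus_space)
  have "(\<Union>n. ?A n) = (\<Union>x\<in>range from_nat. cell K (W_plus E) x (W_plus E))"
    by blast
  then show "(\<Union>n. ?A n) = W_hit E K"
    by (simp add: UN_cell)
  show "emeasure Q (?A n) \<noteq> \<infinity>" for n by simp
qed

lemma Q_measure_eq: "finite K \<Longrightarrow> Q_measure E a K = entrance_measure K"
  unfolding Q_measure_def using is_Q_unique is_Q_entrance_measure by blast

section \<open>Exhaustion by finite sets and uniqueness\<close>

definition exhaustion :: "nat \<Rightarrow> 'v set" where
  "exhaustion n = {x. to_nat x < n}"

lemma finite_exhaustion: "finite (exhaustion n)"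
  using finite_vimageI[of "{..<n}" "to_nat :: 'v \<Rightarrow> nat"] by (simp add: exhaustion_def vimage_def)

lemma incseq_W_star_hit_exhaustion: "incseq (\<lambda>n. W_star_hit E (exhaustion n))"
proof (rule monoI)
  fix m n :: nat assume "m \<le> n"
  then have "exhaustion m \<subseteq> exhaustion n"
    by (auto simp: exhaustion_def)
  then have "W_hit E (exhaustion m) \<subseteq> W_hit E (exhaustion n)"
    by (auto simp: W_hit_def)
  then show "W_star_hit E (exhaustion m) \<subseteq> W_star_hit E (exhaustion n)"
    unfolding W_star_hit_def by (rule image_mono)
qed

lemma UN_W_star_hit_exhaustion: "(\<Union>n. W_star_hit E (exhaustion n)) = W_star E"
proof -
  have "w \<in> W_hit E (exhaustion (Suc (to_nat (w 0))))" if "w \<in> W E" for w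
    using that by (auto simp: W_hit_def exhaustion_def)
  then have "W E \<subseteq> (\<Union>n. W_hit E (exhaustion n))"
    by blast
  moreover have "(\<Union>n. W_hit E (exhaustion n)) \<subseteq> W E"
    by (auto simp: W_hit_def)
  ultimately have "(\<Union>n. W_hit E (exhaustion n)) = W E"
    by (rule subset_antisym[rotated])
  then have "(\<Union>n. W_star_hit E (exhaustion n)) = proj_star E ` W E"
    by (simp only: W_star_hit_def flip: image_UN)
  also have "\<dots> = W_star E"
    by (auto simp: W_star_def quotient_def proj_star_def)
  finally show ?thesis .
qed

lemma sets_interlacement: "sets interlacement = sets (W_star_space E)"
  by (simp add: interlacement_def)

lemma sigma_finite_interlacement: "sigma_finite_measure interlacement"
proof
  let ?C = "range (\<lambda>n. W_star_hit E (exhaustion n))"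
  have "emeasure interlacement (W_star_hit E (exhaustion n)) \<noteq> \<infinity>" for n
  proof -
    let ?K = "exhaustion n" and ?H = "W_star_hit E (exhaustion n)"
    interpret finite_measure "entrance_measure ?K"
      by (rule finite_entrance_measure) (rule finite_exhaustion)
    interpret D: finite_measure "distr (entrance_measure ?K) (W_star_space E) (proj_star E)"
      by (rule finite_measure_distr) (rule measurable_proj_star[of "W_hit E ?K"],
        auto simp: W_hit_def[of E] W_hit_measurable entrance_measure_def sets_restrict_density)
    have "emeasure interlacement ?H = emeasure (density interlacement (indicator ?H)) ?H"
      by (subst emeasure_restricted) (simp_all add: sets_interlacement W_star_hit_measurable)
    also have "\<dots> \<noteq> \<infinity>"
      unfolding density_interlacement[OF finite_exhaustion] by simp
    finally show ?thesis .
  qed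
  then show "\<exists>A. countable A \<and> A \<subseteq> sets interlacement \<and> \<Union> A = space interlacement \<and> (\<forall>a\<in>A. emeasure interlacement a \<noteq> \<infinity>)"
    using UN_W_star_hit_exhaustion
    by (intro exI[of _ ?C]) (auto simp: sets_interlacement W_star_hit_measurable interlacement_def)
qed

lemma interlacement_unique:
  assumes sets: "sets \<nu> = sets (W_star_space E)"
    and local: "\<And>K. finite K \<Longrightarrow>
      density \<nu> (indicator (W_star_hit E K)) = distr (entrance_measure K) (W_star_space E) (proj_star E)"
  shows "\<nu> = interlacement"
proof (rule measure_eqI)
  show "sets \<nu> = sets interlacement" by (simp add: sets sets_interlacement)
  fix A assume "A \<in> sets \<nu>"
  then have A: "A \<in> sets (W_star_space E)" by (simp add: sets)
  let ?H = "\<lambda>n. W_star_hit E (exhaustion n)"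
  have exhaust: "emeasure N A = (SUP n. emeasure (density N (indicator (?H n))) A)"
    if N: "sets N = sets (W_star_space E)" for N
  proof -
    have "A \<subseteq> W_star E" using A by (simp add: in_sets_W_star_space)
    then have "A = (\<Union>n. ?H n \<inter> A)"
      using UN_W_star_hit_exhaustion by blast
    moreover have "incseq (\<lambda>n. ?H n \<inter> A)"
      using incseq_W_star_hit_exhaustion by (fastforce simp: incseq_def)
    ultimately have "emeasure N A = (SUP n. emeasure N (?H n \<inter> A))"
      using A W_star_hit_measurable[of E] by (subst SUP_emeasure_incseq) (auto simp: N)
    also have "\<dots> = (SUP n. emeasure (density N (indicator (?H n))) A)"
      using A W_star_hit_measurable[of E] by (simp add: emeasure_restricted N)
    finally show ?thesis .
  qed
  show "emeasure \<nu> A = emeasure interlacement A"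
    by (simp add: exhaust sets sets_interlacement local density_interlacement finite_exhaustion)
qed

end

theorem theorem2p1:
  fixes E :: "'v::countable set set" and a :: "'v \<Rightarrow> 'v \<Rightarrow> real"
  assumes "weighted_graph E a"
    and "transient E a"
  shows "(\<forall>K. finite K \<longrightarrow> (\<exists>!Q. is_Q E a K Q)) \<and>
    (\<exists>!\<nu>. sets \<nu> = sets (W_star_space E) \<and> sigma_finite_measure \<nu> \<and>
       (\<forall>K. finite K \<longrightarrow>
          density \<nu> (indicator (W_star_hit E K)) =
          distr (Q_measure E a K) (W_star_space E) (proj_star E)))"
proof -
  interpret weighted_graph E a by fact
  show ?thesis
  proof (intro conjI allI impI)
    show "\<exists>!Q. is_Q E a K Q" if "finite K" for K
      using that is_Q_entrance_measure is_Q_unique by blast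
    show "\<exists>!\<nu>. sets \<nu> = sets (W_star_space E) \<and> sigma_finite_measure \<nu> \<and>
       (\<forall>K. finite K \<longrightarrow> density \<nu> (indicator (W_star_hit E K)) =
          distr (Q_measure E a K) (W_star_space E) (proj_star E))"
      by (rule ex1I[of _ interlacement])
         (auto simp: Q_measure_eq sets_interlacement sigma_finite_interlacement density_interlacement
           intro: interlacement_unique)
  qed
qed

end
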